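(* Let $\mathfrak g$ be a real nilpotent Lie algebra of dimension $\leq 8$ endowed with a complex structure $J$. Then $\mathfrak g$ has a non-trivial abelian $J$-invariant ideal if and only if $\mathfrak g$ is not isomorphic to any of the $8$-dimensional Lie algebras $$\mathfrak g_9^{\gamma} = (0^3,\, 13,\, 23,\, 35,\, \gamma\cdot 12-34,\, 16+27+45),\qquad \gamma\in\{0,1\},$$ $$\mathfrak g_{11}^{\alpha, \beta} = (0^3,\, 13,\, 23,\, 14+25-35,\, \alpha \cdot 12+15+24+34,\, 16+27-45-\beta(2\cdot 25 + 35)),$$ where $(\alpha, \beta)=(0,0)$, $(1,0)$, $(0,1)$, or $(\alpha, 1)$ with $\alpha\in\mathbb R$, $\alpha>0$.
   Context: A complex structure on a real Lie algebra $\mathfrak g$ is a linear endomorphism $J:\mathfrak g\to\mathfrak g$ with $J^2=-\mathrm{Id}$ and $[X,Y]+J[JX,Y]+J[X,JY]-[JX,JY]=0$ for all $X,Y\in\mathfrak g$. An ideal $\mathfrak f$ is $J$-invariant if $J\mathfrak f\subseteq\mathfrak f$; non-trivial means $\mathfrak f\neq\{0\}$ (the whole algebra $\mathfrak g$ is allowed). Lie algebras are of positive dimension. Notation for Lie algebras: an 8-tuple lists the Chevalley–Eilenberg differentials $(de^1,\dots,de^8)$ of a basis $\{e^j\}_{j=1}^8$ of $\mathfrak g^*$, where $de(X,Y)=-e([X,Y])$; $ij$ stands for $e^i\wedge e^j$, $c\cdot ij$ for $c\,e^i\wedge e^j$, and $0^k$ for $k$ consecutive zero entries. *)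

theory Defs
  imports "HOL-Analysis.Analysis"
begin

definition lie_algebra :: "('a::real_vector \<Rightarrow> 'a \<Rightarrow> 'a) \<Rightarrow> bool" where
  "lie_algebra br \<longleftrightarrow>
     bilinear br \<and>
     (\<forall>X. br X X = 0) \<and>
     (\<forall>X Y Z. br X (br Y Z) + br Y (br Z X) + br Z (br X Y) = 0)"

primrec lower_central_series :: "('a::real_vector \<Rightarrow> 'a \<Rightarrow> 'a) \<Rightarrow> nat \<Rightarrow> 'a set" where
  "lower_central_series br 0 = UNIV"
| "lower_central_series br (Suc k) = span {br X Y | X Y. Y \<in> lower_central_series br k}"

definition nilpotent_lie :: "('a::real_vector \<Rightarrow> 'a \<Rightarrow> 'a) \<Rightarrow> bool" where
  "nilpotent_lie br \<longleftrightarrow> (\<exists>k. lower_central_series br k = {0})"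

definition complex_structure :: "('a::real_vector \<Rightarrow> 'a \<Rightarrow> 'a) \<Rightarrow> ('a \<Rightarrow> 'a) \<Rightarrow> bool" where
  "complex_structure br J \<longleftrightarrow>
     linear J \<and>
     (\<forall>X. J (J X) = - X) \<and>
     (\<forall>X Y. br X Y + J (br (J X) Y) + J (br X (J Y)) - br (J X) (J Y) = 0)"

definition lie_ideal :: "('a::real_vector \<Rightarrow> 'a \<Rightarrow> 'a) \<Rightarrow> 'a set \<Rightarrow> bool" where
  "lie_ideal br F \<longleftrightarrow> subspace F \<and> (\<forall>X. \<forall>Y\<in>F. br X Y \<in> F)"

definition abelian_on :: "('a::real_vector \<Rightarrow> 'a \<Rightarrow> 'a) \<Rightarrow> 'a set \<Rightarrow> bool" where
  "abelian_on br F \<longleftrightarrow> (\<forall>X\<in>F. \<forall>Y\<in>F. br X Y = 0)"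

definition lie_isomorphic ::
    "('a::real_vector \<Rightarrow> 'a \<Rightarrow> 'a) \<Rightarrow> ('b::real_vector \<Rightarrow> 'b \<Rightarrow> 'b) \<Rightarrow> bool" where
  "lie_isomorphic br br' \<longleftrightarrow>
     (\<exists>\<phi>. linear \<phi> \<and> bij \<phi> \<and> (\<forall>X Y. \<phi> (br X Y) = br' (\<phi> X) (\<phi> Y)))"

text \<open>
  The value at \<open>(X, Y)\<close> of the 2-form \<open>e\<^sup>i \<and> e\<^sup>j\<close>, where \<open>e\<^sup>1, \<dots>, e\<^sup>8\<close> is the dual of the
  standard basis. In the numeral type \<open>8\<close> the index \<open>8\<close> equals \<open>0\<close>, so the indices
  \<open>1, \<dots>, 8\<close> are distinct and exhaust the type.
\<close>

definition wedge :: "8 \<Rightarrow> 8 \<Rightarrow> real^8 \<Rightarrow> real^8 \<Rightarrow> real" where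
  "wedge i j X Y = X $ i * Y $ j - X $ j * Y $ i"

text \<open>
  The lists are the tuples \<open>(de\<^sup>1, \<dots>, de\<^sup>8)\<close> evaluated at \<open>(X, Y)\<close>; the minus sign in front
  comes from \<open>de(X, Y) = - e([X, Y])\<close>.
\<close>

definition g9 :: "real \<Rightarrow> real^8 \<Rightarrow> real^8 \<Rightarrow> real^8" where
  "g9 \<gamma> X Y = (let w = (\<lambda>i j. wedge i j X Y) in
     - vector [0, 0, 0,
               w 1 3,
               w 2 3,
               w 3 5,
               \<gamma> * w 1 2 - w 3 4,
               w 1 6 + w 2 7 + w 4 5])"

definition g11 :: "real \<Rightarrow> real \<Rightarrow> real^8 \<Rightarrow> real^8 \<Rightarrow> real^8" where
  "g11 \<alpha> \<beta> X Y = (let w = (\<lambda>i j. wedge i j X Y) in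
     - vector [0, 0, 0,
               w 1 3,
               w 2 3,
               w 1 4 + w 2 5 - w 3 5,
               \<alpha> * w 1 2 + w 1 5 + w 2 4 + w 3 4,
               w 1 6 + w 2 7 - w 4 5 - \<beta> * (2 * w 2 5 + w 3 5)])"

end

theory Submission
  imports Defs
begin

text \<open>
  Let \<open>z \<noteq> 0\<close> be central and \<open>w = J z\<close>. Integrability of \<open>J\<close> makes \<open>D = [w, \<cdot>]\<close> complex linear,
  and by nilpotency its image avoids \<open>\<complex>z\<close>. An Engel-type argument shows that a \<open>J\<close>-invariant
  set acting on a complex line acts trivially.

  If \<open>D\<^sup>2 = 0\<close>, dimension at most 8 forces \<open>D\<close> to have complex rank at most 1. Then either \<open>\<complex>z\<close> is
  central, or one of \<open>ker D\<close> and \<open>\<complex>z + im D\<close> is an abelian ideal.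

  If \<open>D\<^sup>2 x \<noteq> 0\<close>, then \<open>x, D x, D\<^sup>2 x, z\<close> is a complex basis and the structure constants can be
  computed. Unless \<open>D\<^sup>2 x\<close> spans a central complex line, they depend, up to a change of basis, on
  two complex numbers \<open>\<theta> = P + iQ\<close> and \<open>g + ih\<close>. Rescaling and rotating \<open>x\<close> and \<open>w\<close> yields the
  family \<open>g9\<close> for \<open>\<theta> = 0\<close> and \<open>g11\<close> for \<open>\<theta> \<noteq> 0\<close>.

  Conversely, a nonzero abelian \<open>J\<close>-invariant ideal contains a central \<open>c \<noteq> 0\<close>, hence \<open>J c\<close>, and so
  \<open>[J c, [J c, \<cdot>]] = 0\<close>. In \<open>g9\<close> and \<open>g11\<close> this is only possible if \<open>J c\<close> is a multiple of \<open>c\<close>.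
\<close>

subsection \<open>Nilpotent Lie algebras with a complex structure\<close>

locale nilpotent_lie_algebra =
  fixes br :: "'a::real_vector \<Rightarrow> 'a \<Rightarrow> 'a"
  assumes lie: "lie_algebra br" and nilpotent: "nilpotent_lie br"
begin

lemma bilinear_br: "bilinear br"
  using lie by (simp add: lie_algebra_def)

lemmas br_simps =
  bilinear_ladd[OF bilinear_br] bilinear_radd[OF bilinear_br]
  bilinear_lsub[OF bilinear_br] bilinear_rsub[OF bilinear_br]
  bilinear_lmul[OF bilinear_br] bilinear_rmul[OF bilinear_br]
  bilinear_lneg[OF bilinear_br] bilinear_rneg[OF bilinear_br]
  bilinear_lzero[OF bilinear_br] bilinear_rzero[OF bilinear_br]

lemma br_self [simp]: "br X X = 0"
  using lie by (simp add: lie_algebra_def)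

lemma br_swap: "br X Y = - br Y X"
proof -
  have "br X Y + br Y X = br (X + Y) (X + Y)"
    unfolding br_simps by simp
  also have "\<dots> = 0" by (rule br_self)
  finally have "br X Y + br Y X = 0" .
  then show ?thesis by (simp add: eq_neg_iff_add_eq_0)
qed

lemma jacobi: "br X (br Y Z) = br (br X Y) Z + br Y (br X Z)"
proof -
  have "br X (br Y Z) + br Y (br Z X) + br Z (br X Y) = 0"
    using lie by (simp add: lie_algebra_def)
  moreover have "br Y (br Z X) = - br Y (br X Z)"
    by (subst br_swap[of Z X]) (simp add: br_simps)
  moreover have "br Z (br X Y) = - br (br X Y) Z" by (rule br_swap)
  ultimately show ?thesis by (simp add: algebra_simps)
qed

section \<open>Engel-type consequences of nilpotency\<close>

lemma lcs_br: "Y \<in> lower_central_series br k \<Longrightarrow> br X Y \<in> lower_central_series br (Suc k)"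
  by (auto intro!: span_base)

text \<open>Let \<open>Suc k\<close> be the least index whose term of the lower central series meets
  \<open>U\<close> inside \<open>W\<close>. A vector of \<open>U\<close> in term \<open>k\<close>
  but outside \<open>W\<close> serves: its brackets with \<open>S\<close> stay in \<open>U\<close>
  and lie in the next term.\<close>

lemma engel:
  assumes "\<And>s y. s \<in> S \<Longrightarrow> y \<in> U \<Longrightarrow> br s y \<in> U"
    and "\<not> U \<subseteq> W" and "0 \<in> W"
  obtains p where "p \<in> U" "p \<notin> W" "\<And>s. s \<in> S \<Longrightarrow> br s p \<in> W"
proof -
  let ?P = "\<lambda>k. U \<inter> lower_central_series br k \<subseteq> W"
  obtain n where "lower_central_series br n = {0}"
    using nilpotent by (auto simp: nilpotent_lie_def)
  then have "?P n" using \<open>0 \<in> W\<close> by auto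
  then have least: "?P (LEAST k. ?P k)" by (rule LeastI)
  have "(LEAST k. ?P k) \<noteq> 0"
  proof
    assume "(LEAST k. ?P k) = 0"
    then have "?P 0" using least by simp
    then show False using assms(2) by simp
  qed
  then obtain k where k: "(LEAST k. ?P k) = Suc k" by (meson not0_implies_Suc)
  then have "\<not> ?P k" using not_less_Least[of k ?P] by simp
  then obtain p where p: "p \<in> U" "p \<in> lower_central_series br k" "p \<notin> W" by auto
  have "br s p \<in> W" if "s \<in> S" for s
    using least[unfolded k] lcs_br[OF p(2)] assms(1)[OF that p(1)] by blast
  then show ?thesis using p that by blast
qed

text \<open>A Nakayama-type argument: feeding the inclusion into itself confines \<open>M\<close> to
  \<open>W\<close> plus ever deeper terms of the lower central series, and these reach 0.\<close>

lemma absorb: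
  assumes W: "subspace W" "\<And>s y. s \<in> S \<Longrightarrow> y \<in> W \<Longrightarrow> br s y \<in> W"
    and M: "M \<subseteq> span (W \<union> {br s m | s m. s \<in> S \<and> m \<in> M})"
  shows "M \<subseteq> W"
proof -
  have step: "br s m \<in> span (W \<union> lower_central_series br (Suc k))"
    if "m \<in> span (W \<union> lower_central_series br k)" "s \<in> S" for s m k
    using that(1)
  proof (induction rule: span_induct_alt)
    case base
    then show ?case by (simp add: br_simps span_zero)
  next
    case (step c x y)
    have "br s x \<in> W \<union> lower_central_series br (Suc k)"
      using step(1) W(2)[OF that(2)] lcs_br by blast
    then show ?case using step(2)
      by (simp add: br_simps span_add span_scale span_base)
  qed
  have "M \<subseteq> span (W \<union> lower_central_series br k)" for k
  proof (induction k)
    case 0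
    then show ?case by simp
  next
    case (Suc k)
    have "span (W \<union> {br s m | s m. s \<in> S \<and> m \<in> M})
      \<subseteq> span (W \<union> lower_central_series br (Suc k))"
      using Suc step by (intro span_minimal subspace_span) (auto intro: span_base)
    then show ?case using M by blast
  qed
  moreover obtain n where "lower_central_series br n = {0}"
    using nilpotent by (auto simp: nilpotent_lie_def)
  ultimately have "M \<subseteq> span (W \<union> {0})" by metis
  also have "\<dots> = W" using W(1) subspace_0[OF W(1)] by (simp add: insert_absorb)
  finally show ?thesis .
qed

text \<open>For nonzero \<open>d\<close>, modulo \<open>W\<close>, \<open>q\<close> would be a
  multiple of its own bracket with \<open>s\<close>, and \<open>absorb\<close> would put it into
  \<open>W\<close>.\<close>

lemma no_eigenvector:
  assumes W: "subspace W" "\<And>y. y \<in> W \<Longrightarrow> br s y \<in> W"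
    and q: "br s q - d *\<^sub>R q \<in> W" "q \<notin> W"
  shows "d = 0"
proof (rule ccontr)
  assume "d \<noteq> 0"
  then have "q = (1/d) *\<^sub>R br s q - (1/d) *\<^sub>R (br s q - d *\<^sub>R q)"
    by (simp add: algebra_simps)
  also have "\<dots> \<in> span (W \<union> {br s' m | s' m. s' \<in> {s} \<and> m \<in> {q}})"
    using q(1) by (intro span_diff[OF span_scale span_scale] span_base) auto
  finally have "{q} \<subseteq> W" using W by (intro absorb[of W "{s}"]) auto
  then show False using q by simp
qed

text \<open>The case \<open>S = UNIV\<close>, \<open>W = {0}\<close> of \<open>engel\<close>. It
  supplies the central vectors from which both directions of the theorem start.\<close>

lemma center_meets_ideal:
  assumes "lie_ideal br F" "F \<noteq> {0}"
  obtains c where "c \<in> F" "c \<noteq> 0" "\<And>X. br X c = 0"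
proof -
  have "0 \<in> F" using assms by (simp add: lie_ideal_def subspace_0)
  then have "\<not> F \<subseteq> {0}" using assms by auto
  then show ?thesis
    using engel[of UNIV F "{0}"] assms that by (auto simp: lie_ideal_def)
qed

end

section \<open>Complex structures and actions on complex lines\<close>

locale nilpotent_complex = nilpotent_lie_algebra br
  for br :: "'a::real_vector \<Rightarrow> 'a \<Rightarrow> 'a" +
  fixes J :: "'a \<Rightarrow> 'a"
  assumes complex: "complex_structure br J"
begin

lemma linear_J: "linear J"
  using complex by (simp add: complex_structure_def)

lemma JJ [simp]: "J (J X) = - X"
  using complex by (simp add: complex_structure_def)

lemmas J_simps [simp] =
  linear_add[OF linear_J] linear_diff[OF linear_J] linear_cmul[OF linear_J]
  linear_neg[OF linear_J] linear_0[OF linear_J]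

lemma nijenhuis: "br X Y + J (br (J X) Y) + J (br X (J Y)) - br (J X) (J Y) = 0"
  using complex by (simp add: complex_structure_def)

text \<open>Applying the conjugate a - bJ of a + bJ yields a^2 + b^2 times \<open>p\<close>.\<close>

lemma line_inj:
  assumes W: "subspace W" "\<And>y. y \<in> W \<Longrightarrow> J y \<in> W" and p: "p \<notin> W"
    and ab: "a *\<^sub>R p + b *\<^sub>R J p \<in> W"
  shows "a = 0" "b = 0"
proof -
  have "a *\<^sub>R (a *\<^sub>R p + b *\<^sub>R J p) - b *\<^sub>R J (a *\<^sub>R p + b *\<^sub>R J p) \<in> W"
    using W(2)[OF ab] ab W(1) by (intro subspace_diff[OF _ subspace_scale subspace_scale])
  also have "a *\<^sub>R (a *\<^sub>R p + b *\<^sub>R J p) - b *\<^sub>R J (a *\<^sub>R p + b *\<^sub>R J p) = (a\<^sup>2 + b\<^sup>2) *\<^sub>R p"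
    by (simp add: algebra_simps power2_eq_square)
  finally have "(a\<^sup>2 + b\<^sup>2) *\<^sub>R p \<in> W" .
  then have "a\<^sup>2 + b\<^sup>2 = 0"
    using p subspace_scale[OF W(1), of "(a\<^sup>2 + b\<^sup>2) *\<^sub>R p" "1 / (a\<^sup>2 + b\<^sup>2)"]
    by (cases "a\<^sup>2 + b\<^sup>2 = 0") auto
  then show "a = 0" "b = 0" by (auto simp: sum_power2_eq_zero_iff)
qed

lemma line_0: "a *\<^sub>R p + b *\<^sub>R J p = 0 \<Longrightarrow> p \<noteq> 0 \<Longrightarrow> a = 0 \<and> b = 0"
  using line_inj[of "{0}" p a b] by auto

text \<open>
  Engel's theorem gives a vector of the line \<open>\<complex>p\<close> killed modulo \<open>W\<close>, and integrability transports this
  to its image under \<open>J\<close>. The larger space \<open>W'\<close> absorbs \<open>J W\<close>, which need not lie in \<open>W\<close>.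
\<close>

lemma complex_line:
  assumes S: "\<And>s. s \<in> S \<Longrightarrow> J s \<in> S"
    and W: "subspace W" "\<And>s y. s \<in> S \<Longrightarrow> y \<in> W \<Longrightarrow> br s y \<in> W"
    and W': "subspace W'" "W \<subseteq> W'" "\<And>y. y \<in> W' \<Longrightarrow> J y \<in> W'"
    and p: "p \<notin> W'"
    and act: "\<And>s. s \<in> S \<Longrightarrow> \<exists>a b. br s p - a *\<^sub>R p - b *\<^sub>R J p \<in> W"
      "\<And>s. s \<in> S \<Longrightarrow> \<exists>a b. br s (J p) - a *\<^sub>R p - b *\<^sub>R J p \<in> W"
    and s: "s \<in> S"
  shows "br s p \<in> W \<and> br s (J p) \<in> W"
proof -
  note sub = subspace_add[OF W(1)] subspace_diff[OF W(1)] subspace_scale[OF W(1)]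
  \<comment> \<open>\<open>?U\<close> is \<open>W\<close> plus the complex line of \<open>p\<close>.
    It is stable under \<open>S\<close>, so \<open>engel\<close> applies to it modulo
    \<open>W\<close>.\<close>
  let ?U = "{y. \<exists>a b. y - a *\<^sub>R p - b *\<^sub>R J p \<in> W}"
  have comb: "y - a *\<^sub>R p - b *\<^sub>R J p \<in> ?U" if y: "y \<in> W" for y a b
  proof -
    have "y - a *\<^sub>R p - b *\<^sub>R J p - (-a) *\<^sub>R p - (-b) *\<^sub>R J p \<in> W" using y by simp
    then show ?thesis by blast
  qed
  have U: "subspace ?U"
    unfolding subspace_def
  proof (intro conjI ballI allI)
    show "0 \<in> ?U" using comb[of 0 0 0] subspace_0[OF W(1)] by simp
  next
    fix y y' assume "y \<in> ?U" "y' \<in> ?U"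
    then obtain a b a' b' where
      "y - a *\<^sub>R p - b *\<^sub>R J p \<in> W" "y' - a' *\<^sub>R p - b' *\<^sub>R J p \<in> W" by blast
    then have "(y - a *\<^sub>R p - b *\<^sub>R J p) + (y' - a' *\<^sub>R p - b' *\<^sub>R J p) \<in> W" by (rule sub)
    then have "y + y' - (a + a') *\<^sub>R p - (b + b') *\<^sub>R J p \<in> W" by (simp add: algebra_simps)
    then show "y + y' \<in> ?U" by blast
  next
    fix c y assume "y \<in> ?U"
    then obtain a b where "y - a *\<^sub>R p - b *\<^sub>R J p \<in> W" by blast
    then have "c *\<^sub>R (y - a *\<^sub>R p - b *\<^sub>R J p) \<in> W" by (rule sub)
    then have "c *\<^sub>R y - (c * a) *\<^sub>R p - (c * b) *\<^sub>R J p \<in> W" by (simp add: algebra_simps)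
    then show "c *\<^sub>R y \<in> ?U" by blast
  qed
  have stable: "br t y \<in> ?U" if t: "t \<in> S" and y: "y \<in> ?U" for t y
  proof -
    obtain a b where ab: "y - a *\<^sub>R p - b *\<^sub>R J p \<in> W" using y by blast
    have "br t (y - a *\<^sub>R p - b *\<^sub>R J p) \<in> ?U"
      using comb[OF W(2)[OF t ab], of 0 0] by simp
    moreover have "br t p \<in> ?U" "br t (J p) \<in> ?U" using act t by auto
    ultimately have
      "br t (y - a *\<^sub>R p - b *\<^sub>R J p) + a *\<^sub>R br t p + b *\<^sub>R br t (J p) \<in> ?U"
      using U by (intro subspace_add subspace_scale)
    then show ?thesis by (simp add: br_simps)
  qed
  have "p - 1 *\<^sub>R p - 0 *\<^sub>R J p \<in> W" using subspace_0[OF W(1)] by simp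
  then have "p \<in> ?U" by blast
  then have "\<not> ?U \<subseteq> W" using p W' by blast
  then obtain p1 where p1: "p1 \<in> ?U" "p1 \<notin> W" "\<And>s. s \<in> S \<Longrightarrow> br s p1 \<in> W"
    using engel[of S ?U W] stable subspace_0[OF W(1)] by blast
  then obtain a b where ab: "p1 - a *\<^sub>R p - b *\<^sub>R J p \<in> W" by blast
  define p0 where "p0 = a *\<^sub>R p + b *\<^sub>R J p"
  have Jp0: "J p0 = a *\<^sub>R J p - b *\<^sub>R p" by (simp add: p0_def)
  have p0W: "br t p0 \<in> W" if "t \<in> S" for t
  proof -
    have "br t p1 - br t (p1 - a *\<^sub>R p - b *\<^sub>R J p) \<in> W"
      using p1(3)[OF that] W(2)[OF that ab] by (rule sub)
    then show ?thesis by (simp add: p0_def br_simps algebra_simps)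
  qed
  have nz: "a\<^sup>2 + b\<^sup>2 \<noteq> 0"
    using ab p1(2) by (auto simp: sum_power2_eq_zero_iff)
  \<comment> \<open>\<open>n\<close> (a - bJ) inverts a + bJ, which recovers \<open>p\<close> from
    \<open>p0\<close>.\<close>
  define n where "n = 1 / (a\<^sup>2 + b\<^sup>2)"
  have n1: "n * a * a + n * b * b = 1"
    using nz by (simp add: n_def power2_eq_square divide_simps)
  have p_eq: "p = (n * a) *\<^sub>R p0 - (n * b) *\<^sub>R J p0"
  proof -
    have "(n * a) *\<^sub>R p0 - (n * b) *\<^sub>R J p0 = (n * a * a + n * b * b) *\<^sub>R p"
      unfolding Jp0 p0_def by (simp add: algebra_simps)
    then show ?thesis using n1 by simp
  qed
  have Jp_eq: "J p = (n * b) *\<^sub>R p0 + (n * a) *\<^sub>R J p0"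
    by (subst p_eq) simp
  have p0: "p0 \<notin> W'"
  proof
    assume "p0 \<in> W'"
    then have "(n * a) *\<^sub>R p0 - (n * b) *\<^sub>R J p0 \<in> W'"
      using W' by (intro subspace_diff subspace_scale) auto
    then show False using p p_eq by simp
  qed
  have act0: "\<exists>c d. br t (J p0) - c *\<^sub>R p0 - d *\<^sub>R J p0 \<in> W" if t: "t \<in> S" for t
  proof -
    have "br t (J p0) = a *\<^sub>R br t (J p) - b *\<^sub>R br t p" by (simp add: Jp0 br_simps)
    also have "\<dots> \<in> ?U" using act t U by (intro subspace_diff subspace_scale) auto
    finally obtain c d where "br t (J p0) - c *\<^sub>R p - d *\<^sub>R J p \<in> W" by blast
    then have "br t (J p0) - (c * (n * a) + d * (n * b)) *\<^sub>R p0
        - (d * (n * a) - c * (n * b)) *\<^sub>R J p0 \<in> W"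
      unfolding p_eq Jp_eq
      by (simp add: algebra_simps)
    then show ?thesis by blast
  qed
  \<comment> \<open>\<open>?V\<close> is \<open>W\<close> plus the real line of \<open>p0\<close>.
    Modulo \<open>?V\<close>, \<open>J p0\<close> is an eigenvector of every element of
    \<open>S\<close>, so its eigenvalue vanishes.\<close>
  let ?V = "{y. \<exists>c. y - c *\<^sub>R p0 \<in> W}"
  have V: "subspace ?V"
    unfolding subspace_def
  proof (intro conjI ballI allI)
    have "0 - 0 *\<^sub>R p0 \<in> W" using subspace_0[OF W(1)] by simp
    then show "0 \<in> ?V" by blast
  next
    fix y y' assume "y \<in> ?V" "y' \<in> ?V"
    then obtain c c' where "y - c *\<^sub>R p0 \<in> W" "y' - c' *\<^sub>R p0 \<in> W" by blast
    then have "(y - c *\<^sub>R p0) + (y' - c' *\<^sub>R p0) \<in> W" by (rule sub)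
    then have "y + y' - (c + c') *\<^sub>R p0 \<in> W" by (simp add: algebra_simps)
    then show "y + y' \<in> ?V" by blast
  next
    fix k y assume "y \<in> ?V"
    then obtain c where "y - c *\<^sub>R p0 \<in> W" by blast
    then have "k *\<^sub>R (y - c *\<^sub>R p0) \<in> W" by (rule sub)
    then have "k *\<^sub>R y - (k * c) *\<^sub>R p0 \<in> W" by (simp add: algebra_simps)
    then show "k *\<^sub>R y \<in> ?V" by blast
  qed
  have WV: "y \<in> ?V" if "y \<in> W" for y
    using that by (auto intro: exI[of _ 0])
  have act1: "\<exists>c. br t (J p0) - c *\<^sub>R p0 \<in> W" if t: "t \<in> S" for t
  proof -
    obtain c d where cd: "br t (J p0) - c *\<^sub>R p0 - d *\<^sub>R J p0 \<in> W" using act0[OF t] by blast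
    have "d = 0"
    proof (rule no_eigenvector[OF V])
      fix y assume "y \<in> ?V"
      then obtain c where c: "y - c *\<^sub>R p0 \<in> W" by blast
      have "br t (y - c *\<^sub>R p0) + c *\<^sub>R br t p0 \<in> W"
        using W(2)[OF t c] p0W[OF t] by (intro sub)
      then show "br t y \<in> ?V" by (intro WV) (simp add: br_simps)
    next
      have "br t (J p0) - d *\<^sub>R J p0 - c *\<^sub>R p0 \<in> W" using cd by (simp add: algebra_simps)
      then show "br t (J p0) - d *\<^sub>R J p0 \<in> ?V" by blast
    next
      show "J p0 \<notin> ?V"
      proof
        assume "J p0 \<in> ?V"
        then obtain c where "J p0 - c *\<^sub>R p0 \<in> W" by blast
        then have "(-c) *\<^sub>R p0 + 1 *\<^sub>R J p0 \<in> W'" using W' by (auto simp: algebra_simps)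
        from line_inj(2)[OF W'(1,3) p0 this] show False by simp
      qed
    qed
    then show ?thesis using cd by auto
  qed
  have p0J: "br t (J p0) \<in> W" if t: "t \<in> S" for t
  proof -
    obtain c where c: "br t (J p0) - c *\<^sub>R p0 \<in> W" using act1[OF t] by blast
    obtain c' where c': "br (J t) (J p0) - c' *\<^sub>R p0 \<in> W" using act1[OF S[OF t]] by blast
    \<comment> \<open>Integrability for \<open>t\<close> and \<open>p0\<close> equates c J p0 and c'
      p0 modulo \<open>W'\<close>, which forces c = 0.\<close>
    have "(br (J t) (J p0) - c' *\<^sub>R p0) - br t p0 - J (br (J t) p0) - J (br t (J p0) - c *\<^sub>R p0) \<in> W'"
      using c c' p0W[OF t] p0W[OF S[OF t]] W'(2,3)
      by (intro subspace_diff[OF W'(1) subspace_diff[OF W'(1) subspace_diff[OF W'(1)]]]) blast+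
    moreover have "(br (J t) (J p0) - c' *\<^sub>R p0) - br t p0 - J (br (J t) p0) - J (br t (J p0) - c *\<^sub>R p0)
        = (- c') *\<^sub>R p0 + c *\<^sub>R J p0"
    proof -
      have "J (br t (J p0)) = br (J t) (J p0) - br t p0 - J (br (J t) p0)"
        using nijenhuis[of t p0] by (simp add: algebra_simps)
      then show ?thesis by simp
    qed
    ultimately have "(- c') *\<^sub>R p0 + c *\<^sub>R J p0 \<in> W'" by (simp only:)
    from line_inj(2)[OF W'(1,3) p0 this] have "c = 0" by simp
    then show ?thesis using c by simp
  qed
  have "br s p = (n * a) *\<^sub>R br s p0 - (n * b) *\<^sub>R br s (J p0)"
    by (subst p_eq) (simp add: br_simps)
  moreover have "br s (J p) = (n * b) *\<^sub>R br s p0 + (n * a) *\<^sub>R br s (J p0)"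
    by (subst Jp_eq) (simp add: br_simps)
  ultimately show ?thesis using p0W[OF s] p0J[OF s] by (auto intro!: sub)
qed

end

subsection \<open>The algebras of the list in coordinates\<close>

lemma UNIV_8: "(UNIV :: 8 set) = {1, 2, 3, 4, 5, 6, 7, 8}"
proof -
  have "card {1, 2, 3, 4, 5, 6, 7, 8 :: 8} = CARD(8)" by simp
  then show ?thesis by (metis card_subset_eq finite subset_UNIV)
qed

lemma forall_8: "(\<forall>i::8. P i) \<longleftrightarrow> P 1 \<and> P 2 \<and> P 3 \<and> P 4 \<and> P 5 \<and> P 6 \<and> P 7 \<and> P 8"
  by (metis UNIV_8 UNIV_I insertE emptyE)

lemma vector_8:
  "(vector [a, b, c, d, e, f, g, h] :: 'a::zero^8) $ 1 = a"
  "(vector [a, b, c, d, e, f, g, h] :: 'a^8) $ 2 = b"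
  "(vector [a, b, c, d, e, f, g, h] :: 'a^8) $ 3 = c"
  "(vector [a, b, c, d, e, f, g, h] :: 'a^8) $ 4 = d"
  "(vector [a, b, c, d, e, f, g, h] :: 'a^8) $ 5 = e"
  "(vector [a, b, c, d, e, f, g, h] :: 'a^8) $ 6 = f"
  "(vector [a, b, c, d, e, f, g, h] :: 'a^8) $ 7 = g"
  "(vector [a, b, c, d, e, f, g, h] :: 'a^8) $ 8 = h"
  unfolding vector_def by simp_all

lemma g9_nth:
  "g9 \<gamma> X Y $ 1 = 0" "g9 \<gamma> X Y $ 2 = 0" "g9 \<gamma> X Y $ 3 = 0"
  "g9 \<gamma> X Y $ 4 = - wedge 1 3 X Y"
  "g9 \<gamma> X Y $ 5 = - wedge 2 3 X Y"
  "g9 \<gamma> X Y $ 6 = - wedge 3 5 X Y"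
  "g9 \<gamma> X Y $ 7 = wedge 3 4 X Y - \<gamma> * wedge 1 2 X Y"
  "g9 \<gamma> X Y $ 8 = - wedge 1 6 X Y - wedge 2 7 X Y - wedge 4 5 X Y"
  by (simp_all add: g9_def Let_def vector_8)

lemma g11_nth:
  "g11 \<alpha> \<beta> X Y $ 1 = 0" "g11 \<alpha> \<beta> X Y $ 2 = 0" "g11 \<alpha> \<beta> X Y $ 3 = 0"
  "g11 \<alpha> \<beta> X Y $ 4 = - wedge 1 3 X Y"
  "g11 \<alpha> \<beta> X Y $ 5 = - wedge 2 3 X Y"
  "g11 \<alpha> \<beta> X Y $ 6 = wedge 3 5 X Y - wedge 1 4 X Y - wedge 2 5 X Y"
  "g11 \<alpha> \<beta> X Y $ 7 =
     - \<alpha> * wedge 1 2 X Y - wedge 1 5 X Y - wedge 2 4 X Y - wedge 3 4 X Y"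
  "g11 \<alpha> \<beta> X Y $ 8 =
     wedge 4 5 X Y - wedge 1 6 X Y - wedge 2 7 X Y + \<beta> * (2 * wedge 2 5 X Y + wedge 3 5 X Y)"
  by (simp_all add: g11_def Let_def vector_8)

text \<open>\<open>W\<close> will be the image of \<open>J c\<close> for a central \<open>c\<close>
  in an abelian \<open>J\<close>-invariant ideal. The square condition kills the third coordinate;
  the image condition kills the others.\<close>

lemma g9_square:
  assumes sq: "\<And>X. g9 \<gamma> W (g9 \<gamma> W X) = 0"
    and img: "\<And>X a. g9 \<gamma> W X = axis 8 a \<Longrightarrow> a = 0"
  obtains a where "W = axis 8 a"
proof -
  have ax: "(axis 8 a :: real^8) = vector [0, 0, 0, 0, 0, 0, 0, a]" for a
    by (simp add: vec_eq_iff forall_8 vector_8 axis_def)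
  note nth = vec_eq_iff forall_8 g9_nth vector_8 wedge_def ax
  \<comment> \<open>This coordinate is the square of \<open>W $ 3\<close>.\<close>
  have "g9 \<gamma> W (g9 \<gamma> W (axis 1 1)) $ 7 = 0" by (simp add: sq)
  then have 3: "W $ 3 = 0" by (simp add: g9_nth wedge_def axis_def)
  \<comment> \<open>Each test vector is chosen so that, given the coordinates already known to
    vanish, its bracket with \<open>W\<close> is a multiple of e8.\<close>
  have 1: "W $ 1 = 0"
    using img[of "axis 6 1" "- W $ 1"] by (simp add: nth axis_def[of 6] 3)
  have 2: "W $ 2 = 0"
    using img[of "axis 7 1" "- W $ 2"] by (simp add: nth axis_def[of 7] 3)
  have 5: "W $ 5 = 0"
    using img[of "axis 4 1" "W $ 5"] by (simp add: nth axis_def[of 4] 3 1 2)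
  have 4: "W $ 4 = 0"
    using img[of "axis 5 1" "- W $ 4"] by (simp add: nth axis_def[of 5] 3 1 2)
  have 6: "W $ 6 = 0"
    using img[of "axis 1 1" "W $ 6"] by (simp add: nth axis_def[of 1] 3 1 2 4 5)
  have 7: "W $ 7 = 0"
    using img[of "axis 2 1" "W $ 7"] by (simp add: nth axis_def[of 2] 3 1 2 4 5)
  have "W = axis 8 (W $ 8)" using 1 2 3 4 5 6 7 by (simp add: nth)
  then show ?thesis by (rule that)
qed

text \<open>A central \<open>W\<close> has zero adjoint and so meets the hypotheses of
  \<open>g9_square\<close>.\<close>

lemma g9_center:
  assumes "\<And>X. g9 \<gamma> X W = 0"
  obtains a where "W = axis 8 a"
proof -
  have swap: "g9 \<gamma> W X = - g9 \<gamma> X W" for X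
    by (simp add: vec_eq_iff forall_8 g9_nth wedge_def algebra_simps)
  show ?thesis
  proof (rule g9_square[of \<gamma> W])
    have "g9 \<gamma> W X = 0" for X using assms swap by simp
    then show "g9 \<gamma> W (g9 \<gamma> W X) = 0" "g9 \<gamma> W X = axis 8 a \<Longrightarrow> a = 0" for X a by auto
  qed (use that in blast)
qed

lemma g11_square:
  assumes sq: "\<And>X. g11 \<alpha> \<beta> W (g11 \<alpha> \<beta> W X) = 0"
    and img: "\<And>X a. g11 \<alpha> \<beta> W X = axis 8 a \<Longrightarrow> a = 0"
  obtains a where "W = axis 8 a"
proof -
  have ax: "(axis 8 a :: real^8) = vector [0, 0, 0, 0, 0, 0, 0, a]" for a
    by (simp add: vec_eq_iff forall_8 vector_8 axis_def)
  note nth = vec_eq_iff forall_8 g11_nth vector_8 wedge_def ax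
  \<comment> \<open>With W2, W3 for the coordinates, these are -W3 (W2 + W3) and W3 (W3 - W2). Both
    vanish only if W3 = 0.\<close>
  have "g11 \<alpha> \<beta> W (g11 \<alpha> \<beta> W (axis 1 1)) $ 7 = 0"
      "g11 \<alpha> \<beta> W (g11 \<alpha> \<beta> W (axis 2 1)) $ 6 = 0" by (simp_all add: sq)
  then have "- (W $ 2 * W $ 3) = W $ 3 * W $ 3" "W $ 3 = 0 \<or> W $ 3 = W $ 2"
    by (auto simp: g11_nth wedge_def axis_def algebra_simps)
  then have 3: "W $ 3 = 0" by auto
  have 1: "W $ 1 = 0"
    using img[of "axis 6 1" "- W $ 1"] by (simp add: nth axis_def[of 6] 3)
  have 2: "W $ 2 = 0"
    using img[of "axis 7 1" "- W $ 2"] by (simp add: nth axis_def[of 7] 3)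
  have 5: "W $ 5 = 0"
    using img[of "axis 4 1" "- W $ 5"] by (simp add: nth axis_def[of 4] 3 1 2)
  have 4: "W $ 4 = 0"
    using img[of "axis 5 1" "W $ 4"] by (simp add: nth axis_def[of 5] 3 1 2)
  have 6: "W $ 6 = 0"
    using img[of "axis 1 1" "W $ 6"] by (simp add: nth axis_def[of 1] 3 1 2 4 5)
  have 7: "W $ 7 = 0"
    using img[of "axis 2 1" "W $ 7"] by (simp add: nth axis_def[of 2] 3 1 2 4 5)
  have "W = axis 8 (W $ 8)" using 1 2 3 4 5 6 7 by (simp add: nth)
  then show ?thesis by (rule that)
qed

lemma g11_center:
  assumes "\<And>X. g11 \<alpha> \<beta> X W = 0"
  obtains a where "W = axis 8 a"
proof -
  have swap: "g11 \<alpha> \<beta> W X = - g11 \<alpha> \<beta> X W" for X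
    by (simp add: vec_eq_iff forall_8 g11_nth wedge_def algebra_simps)
  show ?thesis
  proof (rule g11_square[of \<alpha> \<beta> W])
    have "g11 \<alpha> \<beta> W X = 0" for X using assms swap by simp
    then show "g11 \<alpha> \<beta> W (g11 \<alpha> \<beta> W X) = 0" "g11 \<alpha> \<beta> W X = axis 8 a \<Longrightarrow> a = 0" for X a by auto
  qed (use that in blast)
qed

section \<open>Dimension counts and coordinate maps\<close>

lemma dim_ge_of_injective:
  fixes f :: "'e::euclidean_space \<Rightarrow> 'a::real_vector"
  assumes f: "linear f" "inj f" and B: "finite B" "span B = (UNIV :: 'a set)"
  shows "DIM('e) \<le> dim (UNIV :: 'a set)"
    and "dim (UNIV :: 'a set) \<le> DIM('e) \<Longrightarrow> surj f"
proof -
  \<comment> \<open>Thinning the spanning set \<open>B\<close> to a basis \<open>C\<close> turns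
    \<open>dim UNIV\<close> into a cardinality.\<close>
  obtain C where C: "C \<subseteq> B" "independent C" "span C = (UNIV :: 'a set)"
    using maximal_independent_subset[of B] B(2) span_minimal subspace_span
    by (metis span_mono span_span subset_antisym top_greatest)
  have finC: "finite C" using C B finite_subset by blast
  have dimC: "dim (UNIV :: 'a set) = card C"
    using dim_eq_card[of C UNIV] C by simp
  have ind: "independent (f ` Basis)"
    using f by (intro linear_independent_injective_image independent_Basis) (auto intro: inj_on_subset)
  have card: "card (f ` Basis) = DIM('e)"
    using f(2) by (intro card_image) (auto intro: inj_on_subset)
  show "DIM('e) \<le> dim (UNIV :: 'a set)"
    using independent_span_bound[OF finC ind] C card dimC by simp
  \<comment> \<open>A vector outside the image would enlarge the image of the basis to an
    independent set with more than \<open>card C\<close> elements.\<close>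
  show "surj f" if le: "dim (UNIV :: 'a set) \<le> DIM('e)"
  proof -
    have "x \<in> span (f ` Basis)" for x
    proof (rule ccontr)
      assume x: "x \<notin> span (f ` Basis)"
      then have "independent (insert x (f ` Basis))" using ind by (simp add: independent_insert)
      then have "card (insert x (f ` Basis)) \<le> card C"
        using independent_span_bound[OF finC] C by simp
      moreover have "card (insert x (f ` Basis)) = Suc (DIM('e))"
        using x card by (subst card_insert_disjoint) (auto intro: span_base)
      ultimately show False using le dimC by simp
    qed
    then show ?thesis
      using linear_span_image[OF f(1), of Basis] by (auto simp: surj_def span_Basis)
  qed
qed

definition comb8 where
  "comb8 b1 b2 b3 b4 b5 b6 b7 b8 (X :: real^8) =
     (X $ 1) *\<^sub>R (b1 :: 'a::real_vector) + (X $ 2) *\<^sub>R b2 + (X $ 3) *\<^sub>R b3 + (X $ 4) *\<^sub>R b4 +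
     (X $ 5) *\<^sub>R b5 + (X $ 6) *\<^sub>R b6 + (X $ 7) *\<^sub>R b7 + (X $ 8) *\<^sub>R b8"

lemma linear_comb8: "linear (comb8 b1 b2 b3 b4 b5 b6 b7 b8)"
  by (rule linearI) (simp_all add: comb8_def algebra_simps)

lemma inj_comb8:
  assumes "\<And>a1 a2 a3 a4 a5 a6 a7 a8 :: real.
    a1 *\<^sub>R b1 + a2 *\<^sub>R b2 + a3 *\<^sub>R b3 + a4 *\<^sub>R b4 + a5 *\<^sub>R b5 + a6 *\<^sub>R b6 + a7 *\<^sub>R b7 + a8 *\<^sub>R b8 = 0 \<Longrightarrow>
    a1 = 0 \<and> a2 = 0 \<and> a3 = 0 \<and> a4 = 0 \<and> a5 = 0 \<and> a6 = 0 \<and> a7 = 0 \<and> a8 = 0"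
  shows "inj (comb8 b1 b2 b3 b4 b5 b6 b7 b8)"
proof (rule linear_injective_0[OF linear_comb8, THEN iffD2], intro allI impI)
  fix X assume "comb8 b1 b2 b3 b4 b5 b6 b7 b8 X = 0"
  from assms[OF this[unfolded comb8_def]] show "X = 0" by (simp add: vec_eq_iff forall_8)
qed

text \<open>Frames yield a map from the model to the algebra, so the required isomorphism is its
  inverse.\<close>

lemma lie_isomorphicI:
  assumes "linear f" "bij f" "\<And>X Y. br (f X) (f Y) = f (br' X Y)"
  shows "lie_isomorphic br br'"
proof -
  have inv: "linear (inv f)"
    using assms(1,2) by (intro linearI inv_f_eq) (auto simp: bij_is_inj bij_is_surj surj_f_inv_f linear_add linear_cmul)
  have "inv f (br X Y) = br' (inv f X) (inv f Y)" for X Y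
    using assms(3)[of "inv f X" "inv f Y"] assms(2)
    by (simp add: bij_is_inj bij_is_surj surj_f_inv_f inv_f_eq)
  then show ?thesis
    unfolding lie_isomorphic_def using inv assms(2) bij_imp_bij_inv by blast
qed

text \<open>By \<open>center\<close> the isomorphism sends \<open>c\<close> to a nonzero multiple of
  e8. Then \<open>square\<close> makes the image of \<open>W\<close> such a multiple as well,
  although \<open>W\<close> is no multiple of \<open>c\<close>.\<close>

lemma axis8_of_nilpotent:
  fixes br :: "'b::real_vector \<Rightarrow> 'b \<Rightarrow> 'b" and br' :: "real^8 \<Rightarrow> real^8 \<Rightarrow> real^8"
  assumes "lie_isomorphic br br'"
    and c: "c \<noteq> 0" "\<And>X. br X c = 0"
    and W: "\<And>X. br W (br W X) = 0" "\<And>X a. br W X = a *\<^sub>R c \<Longrightarrow> a = 0"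
      "\<And>a. W \<noteq> a *\<^sub>R c"
    and center: "\<And>W. (\<And>X. br' X W = 0) \<Longrightarrow> \<exists>a. W = axis 8 a"
    and square: "\<And>W. (\<And>X. br' W (br' W X) = 0) \<Longrightarrow>
      (\<And>X a. br' W X = axis 8 a \<Longrightarrow> a = 0) \<Longrightarrow> \<exists>a. W = axis 8 a"
  shows False
proof -
  obtain \<phi> where lin: "linear \<phi>" and bij: "bij \<phi>"
      and hom: "\<And>X Y. \<phi> (br X Y) = br' (\<phi> X) (\<phi> Y)"
    using assms(1) by (auto simp: lie_isomorphic_def)
  have surj: "\<exists>X. Y = \<phi> X" for Y using bij by (meson bij_is_surj surjE)
  have inj: "\<phi> X = \<phi> Y \<longleftrightarrow> X = Y" for X Y using bij by (simp add: bij_is_inj inj_eq)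
  have zero: "\<phi> X = 0 \<longleftrightarrow> X = 0" for X using inj[of X 0] linear_0[OF lin] by simp
  have "br' Y (\<phi> c) = 0" for Y
    using surj[of Y] c(2) zero by (auto simp flip: hom)
  then obtain k where k: "\<phi> c = axis 8 k" using center by blast
  have k0: "k \<noteq> 0" using c(1) zero[of c] k by (auto simp: axis_def vec_eq_iff)
  have ax: "axis 8 a = \<phi> ((a / k) *\<^sub>R c)" for a
    using k0 by (auto simp: linear_cmul[OF lin] k axis_def vec_eq_iff)
  have "br' (\<phi> W) (br' (\<phi> W) Y) = 0" for Y
    using surj[of Y] W(1) zero by (auto simp flip: hom)
  moreover have "a = 0" if "br' (\<phi> W) Y = axis 8 a" for Y a
  proof -
    obtain X where X: "Y = \<phi> X" using surj by blast
    have "br W X = (a / k) *\<^sub>R c"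
      using that unfolding ax X by (simp add: inj flip: hom)
    then show ?thesis using W(2) k0 by fastforce
  qed
  ultimately obtain a where "\<phi> W = axis 8 a" using square by blast
  then show False using W(3) unfolding ax inj by blast
qed

subsection \<open>Normal forms of the structure constants\<close>

context nilpotent_lie_algebra
begin

text \<open>
  Here \<open>w = J z'\<close> for a real multiple \<open>z'\<close> of \<open>z\<close>, up to the changes of basis below, which do not
  respect \<open>J\<close>; the pairs \<open>(x, y)\<close>, \<open>(v, v')\<close>, \<open>(u, u')\<close> start out as complex lines. For \<open>m = 0\<close> the
  brackets of \<open>x, y\<close> with \<open>v, v'\<close> are the real form of
  \<open>(x, v) \<mapsto> \<theta>\<^sup>* x v - \<theta> (x v\<^sup>* + x\<^sup>* v)\<close> with \<open>\<theta> = P + iQ\<close> and \<open>*\<close> for conjugation.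
\<close>

definition frame where
  "frame x y w v v' u u' z P Q m r g h \<longleftrightarrow>
     z \<noteq> 0 \<and> (\<forall>X. br X z = 0) \<and>
     br w x = v \<and> br w y = v' \<and> br w v = u \<and> br w v' = u' \<and> br w u = 0 \<and> br w u' = 0 \<and>
     br x u = 0 \<and> br x u' = z \<and> br y u = - z \<and> br y u' = 0 \<and>
     br v v' = - z \<and> br v u = 0 \<and> br v u' = 0 \<and> br v' u = 0 \<and> br v' u' = 0 \<and> br u u' = 0 \<and>
     br x v = - P *\<^sub>R u - (3 * Q) *\<^sub>R u' + m *\<^sub>R z \<and>
     br x v' = Q *\<^sub>R u + P *\<^sub>R u' \<and>
     br y v = Q *\<^sub>R u + P *\<^sub>R u' \<and>
     br y v' = - (3 * P) *\<^sub>R u - Q *\<^sub>R u' + m *\<^sub>R z \<and>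
     br x y = r *\<^sub>R z + g *\<^sub>R u + h *\<^sub>R u'"

lemma frame_brackets:
  assumes "frame x y w v v' u u' z P Q m r g h"
  shows "z \<noteq> 0" "br X z = 0" "br z X = 0"
    "br w x = v" "br w y = v'" "br w v = u" "br w v' = u'" "br w u = 0" "br w u' = 0"
    "br x w = - v" "br y w = - v'" "br v w = - u" "br v' w = - u'" "br u w = 0" "br u' w = 0"
    "br x u = 0" "br x u' = z" "br y u = - z" "br y u' = 0"
    "br u x = 0" "br u' x = - z" "br u y = z" "br u' y = 0"
    "br v v' = - z" "br v u = 0" "br v u' = 0" "br v' u = 0" "br v' u' = 0" "br u u' = 0"
    "br v' v = z" "br u v = 0" "br u' v = 0" "br u v' = 0" "br u' v' = 0" "br u' u = 0"
    "br x v = - P *\<^sub>R u - (3 * Q) *\<^sub>R u' + m *\<^sub>R z"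
    "br x v' = Q *\<^sub>R u + P *\<^sub>R u'"
    "br y v = Q *\<^sub>R u + P *\<^sub>R u'"
    "br y v' = - (3 * P) *\<^sub>R u - Q *\<^sub>R u' + m *\<^sub>R z"
    "br x y = r *\<^sub>R z + g *\<^sub>R u + h *\<^sub>R u'"
    "br v x = P *\<^sub>R u + (3 * Q) *\<^sub>R u' - m *\<^sub>R z"
    "br v' x = - Q *\<^sub>R u - P *\<^sub>R u'"
    "br v y = - Q *\<^sub>R u - P *\<^sub>R u'"
    "br v' y = (3 * P) *\<^sub>R u + Q *\<^sub>R u' - m *\<^sub>R z"
    "br y x = - r *\<^sub>R z - g *\<^sub>R u - h *\<^sub>R u'"
  using assms unfolding frame_def
  by (simp_all add: br_swap[of z X] br_swap[of x w] br_swap[of y w] br_swap[of v w]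
      br_swap[of v' w] br_swap[of u w] br_swap[of u' w] br_swap[of u x] br_swap[of u' x]
      br_swap[of u y] br_swap[of u' y] br_swap[of v' v] br_swap[of u v] br_swap[of u' v]
      br_swap[of u v'] br_swap[of u' v'] br_swap[of u' u] br_swap[of v x] br_swap[of v' x]
      br_swap[of v y] br_swap[of v' y] br_swap[of y x])

text \<open>Splitting numeral factors makes distinct monomials the only scalars, so that
  \<open>algebra_simps\<close> decides identities between vectors.\<close>

lemma numeral_split:
  fixes V :: "'b::real_vector"
  shows "(a * 2) *\<^sub>R V = a *\<^sub>R V + a *\<^sub>R V"
    "(a * 3) *\<^sub>R V = a *\<^sub>R V + a *\<^sub>R V + a *\<^sub>R V"
    "(a * 4) *\<^sub>R V = a *\<^sub>R V + a *\<^sub>R V + a *\<^sub>R V + a *\<^sub>R V"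
    "(b * (a * 2)) *\<^sub>R V = (b * a) *\<^sub>R V + (b * a) *\<^sub>R V"
    "(b * (a * 3)) *\<^sub>R V = (b * a) *\<^sub>R V + (b * a) *\<^sub>R V + (b * a) *\<^sub>R V"
    "(b * (a * 4)) *\<^sub>R V = (b * a) *\<^sub>R V + (b * a) *\<^sub>R V + (b * a) *\<^sub>R V + (b * a) *\<^sub>R V"
    "(c * (b * (a * 3))) *\<^sub>R V = (c * (b * a)) *\<^sub>R V + (c * (b * a)) *\<^sub>R V + (c * (b * a)) *\<^sub>R V"
  by (simp_all flip: scaleR_add_left)

section \<open>Changes of frame\<close>

lemma frame_clear_r:
  assumes "frame x y w v v' u u' z P Q m r g h"
  shows "frame (x - (r/2) *\<^sub>R u) (y - (r/2) *\<^sub>R u') w v v' u u' z P Q m 0 g h"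
  \<comment> \<open>Each of the two corrections contributes -(r/2) z to [x, y].\<close>
  unfolding frame_def
  by (simp add: frame_brackets[OF assms] br_simps) (simp add: diff_eq_eq flip: scaleR_add_left)

text \<open>In complex notation x becomes x + ikv. This trades \<open>m\<close> against g + ih,
  which moves by 4k\<theta>: it can remove \<open>m\<close> when \<theta> = 0, and \<open>h\<close>
  when \<theta> = i.\<close>

lemma frame_shift:
  assumes "frame x y w v v' u u' z P Q m r g h"
  shows "\<exists>x1 y1 v1 v1' r1.
    frame x1 y1 w v1 v1' u u' z P Q (m + 2 * k) r1 (g + 4 * k * P) (h + 4 * k * Q)"
proof -
  have "frame (x + k *\<^sub>R v') (y - k *\<^sub>R v) w (v + k *\<^sub>R u') (v' - k *\<^sub>R u) u u' z P Q
      (m + 2 * k) (r - 2 * k * m - k * k) (g + 4 * k * P) (h + 4 * k * Q)"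
    unfolding frame_def
    by (simp add: frame_brackets[OF assms] br_simps) (simp add: algebra_simps numeral_split)
  then show ?thesis by blast
qed

text \<open>Reflection at the imaginary axis of the complex coordinate. It reverses \<open>m\<close>
  but keeps \<open>Q\<close> and \<open>g\<close>, which frees the sign of \<beta>.\<close>

lemma frame_flip:
  assumes "frame x y w v v' u u' z 0 Q m r g 0"
  shows "frame (- x) y w (- v) v' (- u) u' (- z) 0 Q (- m) r g 0"
  unfolding frame_def by (simp add: frame_brackets[OF assms] br_simps)

text \<open>Giving \<open>w\<close>, \<open>v\<close>, \<open>v'\<close> weight t and
  \<open>u\<close>, \<open>u'\<close>, \<open>z\<close> weight t^2 preserves the constant
  brackets.\<close>

lemma frame_scale:
  assumes F: "frame x y w v v' u u' z P Q m r g h" and t: "t \<noteq> 0"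
  shows "\<exists>w1 v1 v1' u1 u1' z1.
    frame x y w1 v1 v1' u1 u1' z1 (P / t) (Q / t) (m / t) (r / t\<^sup>2) (g / t\<^sup>2) (h / t\<^sup>2)"
proof -
  have "frame x y (t *\<^sub>R w) (t *\<^sub>R v) (t *\<^sub>R v') (t\<^sup>2 *\<^sub>R u) (t\<^sup>2 *\<^sub>R u') (t\<^sup>2 *\<^sub>R z)
      (P / t) (Q / t) (m / t) (r / t\<^sup>2) (g / t\<^sup>2) (h / t\<^sup>2)"
    using t unfolding frame_def
    by (simp add: frame_brackets[OF F] br_simps power2_eq_square) (simp add: algebra_simps)
  then show ?thesis by blast
qed

text \<open>This multiplies x, v and u by a + ib and \<open>z\<close> by its squared modulus, hence
  both \<theta> and g + ih by a - ib.\<close>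

lemma frame_rotate:
  assumes F: "frame x y w v v' u u' z P Q m r g h" and N: "a\<^sup>2 + b\<^sup>2 \<noteq> 0"
  shows "\<exists>x1 y1 v1 v1' u1 u1' z1.
    frame x1 y1 w v1 v1' u1 u1' z1 (P * a + Q * b) (Q * a - P * b) m r
       (g * a + h * b) (h * a - g * b)"
proof -
  have N': "a * a + b * b \<noteq> 0" using N by (simp add: power2_eq_square)
  have "frame (a *\<^sub>R x + b *\<^sub>R y) (a *\<^sub>R y - b *\<^sub>R x) w
     (a *\<^sub>R v + b *\<^sub>R v') (a *\<^sub>R v' - b *\<^sub>R v)
     (a *\<^sub>R u + b *\<^sub>R u') (a *\<^sub>R u' - b *\<^sub>R u) ((a * a + b * b) *\<^sub>R z)
     (P * a + Q * b) (Q * a - P * b) m r (g * a + h * b) (h * a - g * b)"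
    using N' unfolding frame_def
    by (simp add: frame_brackets[OF F] br_simps) (simp add: algebra_simps numeral_split)
  then show ?thesis by blast
qed

lemma frame_g9:
  assumes F: "frame x y w v v' u u' z 0 0 m r g h"
  obtains \<gamma> x y w v v' u u' z where "\<gamma> = 0 \<or> \<gamma> = 1" "frame x y w v v' u u' z 0 0 0 0 (- \<gamma>) 0"
proof -
  obtain x1 y1 v1 v1' r1 where F1: "frame x1 y1 w v1 v1' u u' z 0 0 0 r1 g h"
    using frame_shift[OF F, of "- m / 2"] by auto
  show ?thesis
  proof (cases "g = 0 \<and> h = 0")
    case True
    then show ?thesis using frame_clear_r[OF F1] that[of 0] by simp
  next
    case False
    define t where "t = sqrt (g\<^sup>2 + h\<^sup>2)"
    have t2: "t\<^sup>2 = g\<^sup>2 + h\<^sup>2" by (simp add: t_def)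
    have N: "g\<^sup>2 + h\<^sup>2 \<noteq> 0" using False by (simp add: sum_power2_eq_zero_iff)
    have t: "t \<noteq> 0" using t2 N by auto
    \<comment> \<open>Rotation by -(g + ih) turns g + ih into -t^2, and scaling by t turns this into
      -1.\<close>
    obtain x2 y2 v2 v2' u2 u2' z2 where F2: "frame x2 y2 w v2 v2' u2 u2' z2 0 0 0 r1 (- (t\<^sup>2)) 0"
      using frame_rotate[OF F1, of "- g" "- h"] N
      by (auto simp: t2 [unfolded power2_eq_square] power2_eq_square algebra_simps)
    obtain w3 v3 v3' u3 u3' z3 where F3: "frame x2 y2 w3 v3 v3' u3 u3' z3 0 0 0 (r1 / t\<^sup>2) (- 1) 0"
      using frame_scale[OF F2 t] t by auto
    show ?thesis using frame_clear_r[OF F3] that[of 1] by simp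
  qed
qed

lemma frame_g11:
  assumes F: "frame x y w v v' u u' z P Q m r g h" and PQ: "P \<noteq> 0 \<or> Q \<noteq> 0"
  obtains \<alpha> \<mu> x y w v v' u u' z where "frame x y w v v' u u' z 0 1 \<mu> 0 \<alpha> 0"
proof -
  have N: "Q\<^sup>2 + P\<^sup>2 \<noteq> 0" using PQ by (auto simp: sum_power2_eq_zero_iff)
  \<comment> \<open>The resulting factor Q + iP is i times the conjugate of \<theta>, so \<theta>
    becomes i times its squared modulus. Scaling then makes it i, and a shift clears
    \<open>h\<close>.\<close>
  obtain x1 y1 v1 v1' u1 u1' z1 g1 h1 where
    F1: "frame x1 y1 w v1 v1' u1 u1' z1 0 (Q\<^sup>2 + P\<^sup>2) m r g1 h1"
    using frame_rotate[OF F, of Q "- P"] N by (auto simp: power2_eq_square algebra_simps)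
  obtain w2 v2 v2' u2 u2' z2 m2 r2 g2 h2 where
    F2: "frame x1 y1 w2 v2 v2' u2 u2' z2 0 1 m2 r2 g2 h2"
    using frame_scale[OF F1 N] N by auto
  obtain x3 y3 v3 v3' r3 m3 where
    F3: "frame x3 y3 w2 v3 v3' u2 u2' z2 0 1 m3 r3 g2 0"
    using frame_shift[OF F2, of "- h2 / 4"] by auto
  show ?thesis using frame_clear_r[OF F3] that by blast
qed

text \<open>Rotating by s and then scaling by s restores \<theta> = i and divides both remaining
  parameters by s.\<close>

lemma frame_g11_scale:
  assumes F: "frame x y w v v' u u' z 0 1 \<mu> 0 \<alpha> 0" and s: "s \<noteq> 0"
  obtains x y w v v' u u' z where "frame x y w v v' u u' z 0 1 (\<mu> / s) 0 (\<alpha> / s) 0"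
proof -
  obtain x1 y1 v1 v1' u1 u1' z1 where
    F1: "frame x1 y1 w v1 v1' u1 u1' z1 0 s \<mu> 0 (\<alpha> * s) 0"
    using frame_rotate[OF F, of s 0] s by auto
  show ?thesis
    using frame_scale[OF F1 s] s that by (auto simp: power2_eq_square)
qed

section \<open>Identification of frames with the listed algebras\<close>

lemma frame_independent:
  assumes F: "frame x y w v v' u u' z P Q m r g h"
    and 0: "a1 *\<^sub>R x + a2 *\<^sub>R y + a3 *\<^sub>R w + a4 *\<^sub>R v + a5 *\<^sub>R v' + a6 *\<^sub>R u' + a7 *\<^sub>R u + a8 *\<^sub>R z = 0"
  shows "a1 = 0 \<and> a2 = 0 \<and> a3 = 0 \<and> a4 = 0 \<and> a5 = 0 \<and> a6 = 0 \<and> a7 = 0 \<and> a8 = 0"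
proof -
  let ?s = "a1 *\<^sub>R x + a2 *\<^sub>R y + a3 *\<^sub>R w + a4 *\<^sub>R v + a5 *\<^sub>R v' + a6 *\<^sub>R u' + a7 *\<^sub>R u + a8 *\<^sub>R z"
  note B = frame_brackets[OF F] br_simps
  have s: "br ?s Y = 0" for Y unfolding 0 by (simp add: br_simps)
  \<comment> \<open>Bracketing the relation with basis vectors isolates the coefficients one after
    another as multiples of \<open>z\<close>; only \<open>a3\<close> needs a second bracket.\<close>
  have 1: "a1 = 0" using s[of u'] by (simp add: B)
  have 2: "a2 = 0" using s[of u] by (simp add: B)
  have 3: "a3 *\<^sub>R u + a5 *\<^sub>R z = 0" using s[of v] by (simp add: B 1 2)
  have "br y (a3 *\<^sub>R u + a5 *\<^sub>R z) = 0" unfolding 3 by (simp add: br_simps)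
  then have 4: "a3 = 0" by (simp add: B)
  then have 5: "a5 = 0" using 3 by (simp add: B)
  have 6: "a4 = 0" using s[of v'] by (simp add: B 1 2 4)
  have 7: "a6 = 0" using s[of x] by (simp add: B 1 2 4 5 6)
  have 8: "a7 = 0" using s[of y] by (simp add: B 1 2 4 5 6)
  show ?thesis using 0 by (simp add: B 1 2 4 5 6 7 8)
qed

lemma frame_iso_g9:
  assumes F: "frame x y w v v' u u' z 0 0 0 0 (- \<gamma>) 0"
    and B: "finite B" "span B = (UNIV :: 'a set)" and dim: "dim (UNIV :: 'a set) \<le> 8"
  shows "lie_isomorphic br (g9 \<gamma>)"
proof -
  \<comment> \<open>The model has [e3, e5] = -e6 and [e3, e4] = e7, hence \<open>- u'\<close> and
    \<open>u\<close> in places 6 and 7. Its bracket [e1, e2] = -\<gamma> e7 explains the parameter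
    \<open>- \<gamma>\<close>.\<close>
  let ?f = "comb8 x y w v v' (- u') u z"
  have inj: "inj ?f"
  proof (rule inj_comb8)
    fix a1 a2 a3 a4 a5 a6 a7 a8 :: real
    assume "a1 *\<^sub>R x + a2 *\<^sub>R y + a3 *\<^sub>R w + a4 *\<^sub>R v + a5 *\<^sub>R v' + a6 *\<^sub>R (- u') + a7 *\<^sub>R u + a8 *\<^sub>R z = 0"
    then show "a1 = 0 \<and> a2 = 0 \<and> a3 = 0 \<and> a4 = 0 \<and> a5 = 0 \<and> a6 = 0 \<and> a7 = 0 \<and> a8 = 0"
      using frame_independent[OF F, of a1 a2 a3 a4 a5 "- a6" a7 a8] by simp
  qed
  have "surj ?f"
    using dim_ge_of_injective(2)[OF linear_comb8 inj B] dim by simp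
  with inj have "bij ?f" by (simp add: bij_def)
  moreover have "br (?f X) (?f Y) = ?f (g9 \<gamma> X Y)" for X Y
    unfolding comb8_def g9_nth wedge_def
    by (simp add: frame_brackets[OF F] br_simps algebra_simps)
  ultimately show ?thesis by (rule lie_isomorphicI[OF linear_comb8])
qed

lemma frame_iso_g11:
  assumes F: "frame x y w v v' u u' z 0 1 \<mu> 0 \<alpha> 0"
    and B: "finite B" "span B = (UNIV :: 'a set)" and dim: "dim (UNIV :: 'a set) \<le> 8"
  shows "lie_isomorphic br (g11 \<alpha> (- \<mu> / sqrt 3))"
proof -
  \<comment> \<open>As 3 k^2 = 1, scaling \<open>x\<close> and \<open>v\<close> by \<open>k\<close>
    turns the coefficient 3 of \<open>u'\<close> in [x, v] into 1, as in [y, v'].\<close>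
  define k where "k = 1 / sqrt 3"
  have k: "k \<noteq> 0" "3 * (k * k) = 1" by (simp_all add: k_def)
  have b: "- \<mu> / sqrt 3 = - \<mu> * k" by (simp add: k_def)
  \<comment> \<open>The correction of \<open>u'\<close> absorbs the \<open>z\<close>-term of
    [kx, kv]. The terms that it leaves in [y, v'] and [w, v'] are those with \<beta> =
    -\<mu>k.\<close>
  let ?f = "comb8 (k *\<^sub>R x) y w (k *\<^sub>R v) v' (u' - (\<mu> * k * k) *\<^sub>R z) (- k *\<^sub>R u) (- k *\<^sub>R z)"
  have inj: "inj ?f"
  proof (rule inj_comb8)
    fix a1 a2 a3 a4 a5 a6 a7 a8 :: real
    assume "a1 *\<^sub>R (k *\<^sub>R x) + a2 *\<^sub>R y + a3 *\<^sub>R w + a4 *\<^sub>R (k *\<^sub>R v) + a5 *\<^sub>R v'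
      + a6 *\<^sub>R (u' - (\<mu> * k * k) *\<^sub>R z) + a7 *\<^sub>R (- k *\<^sub>R u) + a8 *\<^sub>R (- k *\<^sub>R z) = 0"
    then have "(a1 * k) *\<^sub>R x + a2 *\<^sub>R y + a3 *\<^sub>R w + (a4 * k) *\<^sub>R v + a5 *\<^sub>R v'
      + a6 *\<^sub>R u' + (- a7 * k) *\<^sub>R u + (- a8 * k - a6 * (\<mu> * k * k)) *\<^sub>R z = 0"
      by (simp add: algebra_simps)
    from frame_independent[OF F this]
    show "a1 = 0 \<and> a2 = 0 \<and> a3 = 0 \<and> a4 = 0 \<and> a5 = 0 \<and> a6 = 0 \<and> a7 = 0 \<and> a8 = 0"
      using k by auto
  qed
  have "surj ?f"
    using dim_ge_of_injective(2)[OF linear_comb8 inj B] dim by simp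
  with inj have "bij ?f" by (simp add: bij_def)
  moreover have "br (?f X) (?f Y) = ?f (g11 \<alpha> (- \<mu> * k) X Y)" for X Y
  proof -
    have k1: "k * (k * (a * (3 * b))) = a * b" for a b
      using k(2) by algebra
    have k2: "(\<mu> * (k * (k * (2 * b)))) *\<^sub>R V = (\<mu> * b) *\<^sub>R V - (\<mu> * (k * (k * b))) *\<^sub>R V"
      for b and V :: 'a
    proof -
      have "\<mu> * (k * (k * (2 * b))) = \<mu> * b - \<mu> * (k * (k * b))"
        using k(2) by algebra
      then show ?thesis by (simp only: scaleR_left_diff_distrib)
    qed
    show ?thesis
      unfolding comb8_def g11_nth wedge_def
      by (simp add: frame_brackets[OF F] br_simps algebra_simps) (simp add: k1 k2)
  qed
  ultimately show ?thesis unfolding b by (rule lie_isomorphicI[OF linear_comb8])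
qed

lemma frame_classified:
  assumes F: "frame x y w v v' u u' z P Q m r g h"
    and B: "finite B" "span B = (UNIV :: 'a set)" and dim: "dim (UNIV :: 'a set) \<le> 8"
  shows "(\<exists>\<gamma>\<in>{0, 1}. lie_isomorphic br (g9 \<gamma>)) \<or>
    (\<exists>(\<alpha>, \<beta>)\<in>{(0, 0), (1, 0), (0, 1)} \<union> {(a, 1) | a. 0 < a}. lie_isomorphic br (g11 \<alpha> \<beta>))"
proof (cases "P = 0 \<and> Q = 0")
  case True
  with F have "frame x y w v v' u u' z 0 0 m r g h" by simp
  then obtain \<gamma> x y w v v' u u' z
    where \<gamma>: "\<gamma> = 0 \<or> \<gamma> = 1" and F: "frame x y w v v' u u' z 0 0 0 0 (- \<gamma>) 0"
    by (rule frame_g9)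
  show ?thesis using frame_iso_g9[OF F B dim] \<gamma> by blast
next
  case False
  then have "P \<noteq> 0 \<or> Q \<noteq> 0" by simp
  then obtain \<alpha> \<mu> x y w v v' u u' z where F: "frame x y w v v' u u' z 0 1 \<mu> 0 \<alpha> 0"
    by (rule frame_g11[OF F])
  have scaled: "lie_isomorphic br (g11 (\<alpha> / s) (- (\<mu> / s) / sqrt 3))"
      "lie_isomorphic br (g11 (\<alpha> / s) (\<mu> / s / sqrt 3))" if s: "s \<noteq> 0" for s
  proof -
    obtain x y w v v' u u' z where F: "frame x y w v v' u u' z 0 1 (\<mu> / s) 0 (\<alpha> / s) 0"
      by (rule frame_g11_scale[OF F s])
    show "lie_isomorphic br (g11 (\<alpha> / s) (- (\<mu> / s) / sqrt 3))"
      by (rule frame_iso_g11[OF F B dim])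
    show "lie_isomorphic br (g11 (\<alpha> / s) (\<mu> / s / sqrt 3))"
      using frame_iso_g11[OF frame_flip[OF F] B dim] by (simp only: minus_minus)
  qed
  have "\<exists>(\<alpha>', \<beta>)\<in>{(0, 0), (1, 0), (0, 1)} \<union> {(a, 1) | a. 0 < a}. lie_isomorphic br (g11 \<alpha>' \<beta>)"
  proof (cases "\<mu> = 0")
    case mu: True
    show ?thesis
    proof (cases "\<alpha> = 0")
      case True
      then have "lie_isomorphic br (g11 0 0)" using scaled(1)[of 1] mu by simp
      then show ?thesis by blast
    next
      case False
      then have "lie_isomorphic br (g11 1 0)" using scaled(1)[OF False] mu by simp
      then show ?thesis by blast
    qed
  next
    case mu: False
    \<comment> \<open>This size makes \<beta> equal to 1 or -1, and the flip corrects its sign.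
      Dividing by \<open>?s\<close> or by \<open>- ?s\<close> makes \<alpha> nonnegative.\<close>
    let ?s = "\<bar>\<mu>\<bar> / sqrt 3"
    have s: "?s > 0" using mu by simp
    have 1: "\<mu> / ?s / sqrt 3 = sgn \<mu>" using mu by (simp add: sgn_if abs_if)
    have neg1: "- (\<mu> / ?s) / sqrt 3 = - sgn \<mu>" "\<mu> / (- ?s) / sqrt 3 = - sgn \<mu>"
        "- (\<mu> / (- ?s)) / sqrt 3 = sgn \<mu>"
      using 1 by (simp_all only: divide_minus_right minus_divide_left[symmetric] minus_minus)
    have pos: "lie_isomorphic br (g11 (\<alpha> / ?s) 1)"
    proof (cases "\<mu> > 0")
      case True
      then show ?thesis using scaled(2)[of ?s, unfolded 1] s by simp
    next
      case False
      then show ?thesis using scaled(1)[of ?s, unfolded neg1] s mu by simp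
    qed
    have neg: "lie_isomorphic br (g11 (\<alpha> / (- ?s)) 1)"
    proof (cases "\<mu> > 0")
      case True
      then show ?thesis using scaled(1)[of "- ?s", unfolded neg1] s by simp
    next
      case False
      then show ?thesis using scaled(2)[of "- ?s", unfolded neg1] s mu by simp
    qed
    consider "\<alpha> = 0" | "\<alpha> / ?s > 0" | "\<alpha> / (- ?s) > 0"
      using s zero_less_divide_iff[of \<alpha> ?s] zero_less_divide_iff[of \<alpha> "- ?s"] by linarith
    then show ?thesis
    proof cases
      case 1
      then show ?thesis using pos by auto
    next
      case 2
      then have "(\<alpha> / ?s, 1) \<in> {(0, 0), (1, 0), (0, 1)} \<union> {(a, 1 :: real) | a. 0 < a}" by blast
      then show ?thesis using pos by blast
    next
      case 3
      then have "(\<alpha> / (- ?s), 1) \<in> {(0, 0), (1, 0), (0, 1)} \<union> {(a, 1 :: real) | a. 0 < a}" by blast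
      then show ?thesis using neg by blast
    qed
  qed
  then show ?thesis by blast
qed

end

subsection \<open>Abelian invariant ideals\<close>

context nilpotent_complex
begin

text \<open>For central \<open>c\<close> two of the four integrability terms vanish.\<close>

lemma ad_J_central:
  assumes "\<And>X. br X c = 0"
  shows "br (J c) (J X) = J (br (J c) X)"
proof -
  have "br c Y = 0" for Y using assms br_swap[of c Y] by simp
  then show ?thesis using nijenhuis[of c X] by simp
qed

text \<open>Otherwise (b + aJ) X would act on \<open>J c\<close> with the nonzero eigenvalue -(a^2 +
  b^2), against nilpotency.\<close>

lemma image_ad_avoids_line:
  assumes c: "c \<noteq> 0" "\<And>X. br X c = 0"
    and comm: "\<And>X. br (J c) (J X) = J (br (J c) X)"
    and X: "br (J c) X = a *\<^sub>R c + b *\<^sub>R J c"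
  shows "a = 0 \<and> b = 0"
proof (rule ccontr)
  assume ab: "\<not> (a = 0 \<and> b = 0)"
  let ?Y = "b *\<^sub>R X + a *\<^sub>R J X"
  have Y: "br (J c) ?Y = (a\<^sup>2 + b\<^sup>2) *\<^sub>R J c"
    by (simp add: br_simps comm X algebra_simps power2_eq_square)
  have "br ?Y (J c) - (- (a\<^sup>2 + b\<^sup>2)) *\<^sub>R J c = 0"
    unfolding br_swap[of ?Y] Y by (simp add: algebra_simps)
  moreover have "J c \<noteq> 0" using c(1) by (metis JJ J_simps(5) neg_equal_0_iff_equal)
  ultimately have "- (a\<^sup>2 + b\<^sup>2) = 0"
    by (intro no_eigenvector[of "{0}" ?Y "J c"]) (auto simp: br_simps)
  then have "a\<^sup>2 + b\<^sup>2 = 0" by (simp only: neg_equal_0_iff_equal)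
  then show False using ab by (simp add: sum_power2_eq_zero_iff)
qed

text \<open>\<open>F\<close> contains a central \<open>c\<close> and \<open>J c\<close>. As [J c, .]
  maps into the abelian ideal \<open>F\<close>, its square is zero, which
  \<open>axis8_of_nilpotent\<close> excludes.\<close>

lemma abelian_ideal_obstructs:
  fixes br' :: "real^8 \<Rightarrow> real^8 \<Rightarrow> real^8"
  assumes F: "lie_ideal br F" "F \<noteq> {0}" "abelian_on br F" "J ` F \<subseteq> F"
    and iso: "lie_isomorphic br br'"
    and center: "\<And>W. (\<And>X. br' X W = 0) \<Longrightarrow> \<exists>a. W = axis 8 a"
    and square: "\<And>W. (\<And>X. br' W (br' W X) = 0) \<Longrightarrow>
      (\<And>X a. br' W X = axis 8 a \<Longrightarrow> a = 0) \<Longrightarrow> \<exists>a. W = axis 8 a"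
  shows False
proof -
  obtain c where c: "c \<in> F" "c \<noteq> 0" "\<And>X. br X c = 0"
    using center_meets_ideal F by blast
  have Jc: "J c \<in> F" using F(4) c(1) by blast
  have in_F: "br (J c) X \<in> F" for X
    using F(1) Jc br_swap[of "J c" X] by (auto simp: lie_ideal_def intro: subspace_neg)
  show False
  proof (rule axis8_of_nilpotent[OF iso c(2,3), of "J c"])
    show "br (J c) (br (J c) X) = 0" for X
      using F(3) Jc in_F by (auto simp: abelian_on_def)
    show "a = 0" if "br (J c) X = a *\<^sub>R c" for X a
      using image_ad_avoids_line[OF c(2,3) ad_J_central[OF c(3)], of X a 0] that by simp
    show "J c \<noteq> a *\<^sub>R c" for a
      using line_0[of "-a" c 1] c(2) by auto
  qed (use center square in auto)
qed

section \<open>The case D^2 = 0\<close>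

definition line where "line p = {a *\<^sub>R p + b *\<^sub>R J p | a b. True}"

lemma lineI: "a *\<^sub>R p + b *\<^sub>R J p \<in> line p"
  by (auto simp: line_def)

lemma subspace_line: "subspace (line p)"
  unfolding subspace_def
proof (intro conjI ballI allI)
  show "0 \<in> line p" using lineI[of 0 p 0] by simp
next
  fix X Y assume "X \<in> line p" "Y \<in> line p"
  then obtain a b a' b' where "X = a *\<^sub>R p + b *\<^sub>R J p" "Y = a' *\<^sub>R p + b' *\<^sub>R J p"
    by (auto simp: line_def)
  then show "X + Y \<in> line p" using lineI[of "a + a'" p "b + b'"] by (simp add: algebra_simps)
next
  fix k X assume "X \<in> line p"
  then obtain a b where "X = a *\<^sub>R p + b *\<^sub>R J p" by (auto simp: line_def)
  then show "k *\<^sub>R X \<in> line p" using lineI[of "k * a" p "k * b"] by (simp add: algebra_simps)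
qed

lemma J_line: "X \<in> line p \<Longrightarrow> J X \<in> line p"
proof -
  assume "X \<in> line p"
  then obtain a b where "X = a *\<^sub>R p + b *\<^sub>R J p" by (auto simp: line_def)
  then show ?thesis using lineI[of "- b" p a] by (simp add: algebra_simps)
qed

lemma line_inj_line:
  assumes "p \<notin> line q" "a *\<^sub>R p + b *\<^sub>R J p \<in> line q"
  shows "a = 0 \<and> b = 0"
  using line_inj[OF subspace_line _ assms] J_line by blast

text \<open>D has complex rank one, so \<open>K\<close> = ker D is an ideal acting trivially on
  \<open>F\<close> = \<complex>z + im D. Whether \<open>F\<close> contains the centralizer of
  \<open>K\<close> in \<open>K\<close> decides which of the two is the ideal sought.\<close>

lemma abelian_ideal_if_square_zero:
  assumes B: "finite B" "span B = (UNIV :: 'a set)" and dim: "dim (UNIV :: 'a set) \<le> 8"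
    and z: "z \<noteq> 0" "\<And>X. br X z = 0"
    and sq: "\<And>X. br (J z) (br (J z) X) = 0" and x: "br (J z) x \<noteq> 0"
  shows "\<exists>F. lie_ideal br F \<and> F \<noteq> {0} \<and> abelian_on br F \<and> J ` F \<subseteq> F"
proof -
  define w where "w = J z"
  have wJ: "br w (J X) = J (br w X)" for X unfolding w_def by (rule ad_J_central[OF z(2)])
  have ww: "br w (br w X) = 0" for X unfolding w_def by (rule sq)
  have avoid: "a = 0 \<and> b = 0" if "br w X = a *\<^sub>R z + b *\<^sub>R w" for X a b
    using image_ad_avoids_line[OF z wJ[unfolded w_def]] that by (simp add: w_def)
  define u where "u = br w x"
  have u0: "u \<noteq> 0" using x by (simp add: u_def w_def)
  have wu: "br w u = 0" "br w (J u) = 0" by (simp_all add: u_def ww wJ)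
  have wx: "br w (J x) = J u" by (simp add: u_def wJ)
  have image: "br w Y \<in> line u" for Y
  proof (rule ccontr)
    assume Y: "br w Y \<notin> line u"
    \<comment> \<open>Otherwise x, Jx, Y, JY, u, Ju, z, w and [w, Y] would be nine independent
      vectors.\<close>
    let ?f = "\<lambda>X. comb8 x (J x) Y (J Y) u (J u) z w (fst X) + (snd X :: real) *\<^sub>R br w Y"
    have lin: "linear ?f"
      by (rule linearI) (simp_all add: comb8_def algebra_simps)
    moreover have "inj ?f"
    proof (rule linear_injective_0[OF lin, THEN iffD2], intro allI impI)
      fix Xt :: "(real^8) \<times> real"
      obtain X t where Xt: "Xt = (X, t)" by (cases Xt)
      assume "?f Xt = 0"
      then have 0: "X $ 1 *\<^sub>R x + X $ 2 *\<^sub>R J x + X $ 3 *\<^sub>R Y + X $ 4 *\<^sub>R J Y + X $ 5 *\<^sub>R u +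
          X $ 6 *\<^sub>R J u + X $ 7 *\<^sub>R z + X $ 8 *\<^sub>R w + t *\<^sub>R br w Y = 0" (is "?s = 0")
        by (simp add: Xt comb8_def)
      have "br w ?s = 0" unfolding 0 by (simp add: br_simps)
      then have 1: "(X $ 1 *\<^sub>R u + X $ 2 *\<^sub>R J u) + (X $ 3 *\<^sub>R br w Y + X $ 4 *\<^sub>R J (br w Y)) = 0"
        by (simp add: br_simps wJ wu ww z u_def add.assoc)
      then have "X $ 3 *\<^sub>R br w Y + X $ 4 *\<^sub>R J (br w Y) = - (X $ 1 *\<^sub>R u + X $ 2 *\<^sub>R J u)"
        by (rule minus_unique[symmetric])
      also have "\<dots> \<in> line u" by (intro subspace_neg[OF subspace_line] lineI)
      finally have "X $ 3 *\<^sub>R br w Y + X $ 4 *\<^sub>R J (br w Y) \<in> line u" .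
      from line_inj_line[OF Y this] have 34: "X $ 3 = 0" "X $ 4 = 0" by simp_all
      have "X $ 1 *\<^sub>R u + X $ 2 *\<^sub>R J u = 0" using 1 by (simp add: 34)
      from line_0[OF this u0] have 12: "X $ 1 = 0" "X $ 2 = 0" by simp_all
      have "br w (X $ 5 *\<^sub>R x + X $ 6 *\<^sub>R J x + t *\<^sub>R Y) = (- X $ 7) *\<^sub>R z + (- X $ 8) *\<^sub>R w"
        using 0 by (simp add: br_simps wx 12 34 flip: u_def)
          (simp add: algebra_simps eq_neg_iff_add_eq_0)
      from avoid[OF this] have 78: "X $ 7 = 0" "X $ 8 = 0" by simp_all
      have "t *\<^sub>R br w Y + 0 *\<^sub>R J (br w Y) = (- X $ 5) *\<^sub>R u + (- X $ 6) *\<^sub>R J u"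
        using 0 by (simp add: 12 34 78) (simp add: algebra_simps eq_neg_iff_add_eq_0)
      also have "\<dots> \<in> line u" by (rule lineI)
      finally have "t *\<^sub>R br w Y + 0 *\<^sub>R J (br w Y) \<in> line u" .
      from line_inj_line[OF Y this] have t: "t = 0" by simp
      have "X $ 5 *\<^sub>R u + X $ 6 *\<^sub>R J u = 0" using 0 by (simp add: 12 34 78 t)
      from line_0[OF this u0] have "X $ 5 = 0" "X $ 6 = 0" by simp_all
      then show "Xt = 0" by (simp add: Xt vec_eq_iff forall_8 12 34 78 t prod_eq_iff)
    qed
    ultimately have "DIM((real^8) \<times> real) \<le> dim (UNIV :: 'a set)"
      by (rule dim_ge_of_injective(1)[OF _ _ B])
    then show False using dim by simp
  qed
  define K where "K = {k. br w k = 0}"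
  have K: "subspace K" by (auto simp: K_def subspace_def br_simps)
  have KJ: "J k \<in> K" if "k \<in> K" for k using that by (simp add: K_def wJ)
  have xK: "x \<notin> K" using u0 by (simp add: K_def u_def)
  have mod_K: "\<exists>a b. Y - a *\<^sub>R x - b *\<^sub>R J x \<in> K" for Y
  proof -
    obtain a b where "br w Y = a *\<^sub>R u + b *\<^sub>R J u" using image[of Y] by (auto simp: line_def)
    then have "br w (Y - a *\<^sub>R x - b *\<^sub>R J x) = 0"
      by (simp add: br_simps wx flip: u_def)
    then show ?thesis unfolding K_def by blast
  qed
  have KK: "br k l \<in> K" if "k \<in> K" "l \<in> K" for k l
    using that by (simp add: K_def jacobi[of w] br_simps)
  \<comment> \<open>\<open>K\<close> acts on the quotient by \<open>K\<close>, a complex line, hence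
    trivially.\<close>
  have Kx: "br k x \<in> K \<and> br k (J x) \<in> K" if "k \<in> K" for k
    by (rule complex_line[where S = K and W = K and W' = K, OF KJ K KK K subset_refl KJ xK mod_K mod_K that])
      simp_all
  have idealK: "br X k \<in> K" if "k \<in> K" for X k
  proof -
    obtain a b where ab: "X - a *\<^sub>R x - b *\<^sub>R J x \<in> K" using mod_K by blast
    have "a *\<^sub>R br k x + b *\<^sub>R br k (J x) \<in> K"
      using Kx[OF that] by (intro subspace_add[OF K] subspace_scale[OF K]) auto
    with KK[OF that ab]
    have "br k (X - a *\<^sub>R x - b *\<^sub>R J x) + (a *\<^sub>R br k x + b *\<^sub>R br k (J x)) \<in> K"
      by (rule subspace_add[OF K])
    then have "br k X \<in> K" by (simp add: br_simps)
    then show ?thesis using subspace_neg[OF K] br_swap[of X k] by simp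
  qed
  have Ku: "br k u = 0 \<and> br k (J u) = 0" if k: "k \<in> K" for k
  proof -
    \<comment> \<open>Since \<open>s\<close> commutes with \<open>w\<close>, [s, Dx] = D [s, x] lies
      in im D.\<close>
    have act: "br s u \<in> line u" "br s (J u) \<in> line u" if "s \<in> K" for s
    proof -
      have "br s u = br w (br s x)" "br s (J u) = br w (br s (J x))"
        using that by (simp_all add: K_def jacobi[of w] br_simps wx flip: u_def)
      then show "br s u \<in> line u" "br s (J u) \<in> line u" using image by simp_all
    qed
    have eq: "(\<exists>a b. X - a *\<^sub>R u - b *\<^sub>R J u \<in> {0}) \<longleftrightarrow> X \<in> line u" for X
      by (auto simp: line_def algebra_simps)
    have "br k u \<in> {0} \<and> br k (J u) \<in> {0}"
    proof (rule complex_line[where S = K and W' = "{0}"])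
      show "\<exists>a b. br s u - a *\<^sub>R u - b *\<^sub>R J u \<in> {0}"
        "\<exists>a b. br s (J u) - a *\<^sub>R u - b *\<^sub>R J u \<in> {0}" if "s \<in> K" for s
        unfolding eq using act that by auto
    qed (use k KJ u0 in \<open>auto simp: br_simps\<close>)
    then show ?thesis by simp
  qed
  define F where "F = {a + b | a b. a \<in> line z \<and> b \<in> line u}"
  have F: "subspace F" unfolding F_def by (intro subspace_sums subspace_line)
  have F_I: "a *\<^sub>R u + b *\<^sub>R J u + (c *\<^sub>R z + d *\<^sub>R w) \<in> F" for a b c d
    unfolding F_def w_def mem_Collect_eq
    by (intro exI[of _ "c *\<^sub>R z + d *\<^sub>R J z"] exI[of _ "a *\<^sub>R u + b *\<^sub>R J u"]) (simp add: lineI)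
  have F_E: "\<exists>a b c d. X = a *\<^sub>R u + b *\<^sub>R J u + (c *\<^sub>R z + d *\<^sub>R w)" if "X \<in> F" for X
    using that unfolding F_def line_def w_def by (auto, metis add.commute)
  have JF: "J X \<in> F" if "X \<in> F" for X
    using that J_line unfolding F_def by fastforce
  have KF: "br k X = 0" if "k \<in> K" "X \<in> F" for k X
  proof -
    have "br k w = 0" using that(1) br_swap[of k w] by (simp add: K_def)
    then show ?thesis using F_E[OF that(2)] Ku[OF that(1)] z by (auto simp: br_simps)
  qed
  have FK: "F \<subseteq> K"
    using F_E wu by (fastforce simp: K_def br_simps z)
  have KeqF: "K \<noteq> {0}" using u0 wu by (auto simp: K_def)
  show ?thesis
  proof (cases "\<exists>c. c \<in> K \<and> c \<notin> F \<and> (\<forall>k\<in>K. br k c = 0)")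
    \<comment> \<open>The centralizer of \<open>K\<close> in \<open>K\<close> lies in
      \<open>F\<close>, and the Jacobi identity puts [X, c] into it.\<close>
    case False
    have "br X c \<in> F" if c: "c \<in> F" for X c
    proof -
      have "br k (br X c) = 0" if k: "k \<in> K" for k
      proof -
        have "br k (br X c) = br (br k X) c + br X (br k c)" by (rule jacobi)
        also have "br k X = - br X k" by (rule br_swap)
        finally show ?thesis using KF[OF idealK[OF k] c] KF[OF k c] by (simp add: br_simps)
      qed
      moreover have "br X c \<in> K" using idealK FK c by blast
      ultimately show ?thesis using False by blast
    qed
    moreover have "F \<noteq> {0}" using F_I[of 1 0 0 0] u0 by auto
    ultimately show ?thesis
      using F JF KF FK by (intro exI[of _ F]) (auto simp: lie_ideal_def abelian_on_def)
  next
    \<comment> \<open>By dimension \<open>c\<close>, \<open>J c\<close> and \<open>F\<close> span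
      \<open>K\<close>. Since \<open>c\<close> and \<open>F\<close> commute with \<open>K\<close>,
      so does \<open>J c\<close>, and \<open>K\<close> is abelian.\<close>
    case True
    then obtain c where c: "c \<in> K" "c \<notin> F" "\<And>k. k \<in> K \<Longrightarrow> br k c = 0" by blast
    have wc: "br w c = 0" "br w (J c) = 0" using c(1) KJ[OF c(1)] by (simp_all add: K_def)
    let ?f = "comb8 x (J x) c (J c) u (J u) z w"
    have "inj ?f"
    proof (rule inj_comb8)
      fix a1 a2 a3 a4 a5 a6 a7 a8 :: real
      assume 0: "a1 *\<^sub>R x + a2 *\<^sub>R J x + a3 *\<^sub>R c + a4 *\<^sub>R J c + a5 *\<^sub>R u + a6 *\<^sub>R J u + a7 *\<^sub>R z + a8 *\<^sub>R w = 0"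
        (is "?s = 0")
      have "br w ?s = 0" unfolding 0 by (simp add: br_simps)
      then have "a1 *\<^sub>R u + a2 *\<^sub>R J u = 0" by (simp add: br_simps wx wc wu z flip: u_def)
      from line_0[OF this u0] have 12: "a1 = 0" "a2 = 0" by simp_all
      have "a3 *\<^sub>R c + a4 *\<^sub>R J c = - (a5 *\<^sub>R u + a6 *\<^sub>R J u + (a7 *\<^sub>R z + a8 *\<^sub>R w))"
        using 0 by (intro minus_unique[symmetric]) (simp add: 12 algebra_simps)
      also have "\<dots> \<in> F" by (intro subspace_neg[OF F] F_I)
      finally have "a3 *\<^sub>R c + a4 *\<^sub>R J c \<in> F" .
      from line_inj[OF F JF c(2) this] have 34: "a3 = 0" "a4 = 0" by simp_all
      have "br w (a5 *\<^sub>R x + a6 *\<^sub>R J x) = (- a7) *\<^sub>R z + (- a8) *\<^sub>R w"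
        using 0 by (simp add: br_simps wx 12 34 flip: u_def)
          (simp add: algebra_simps eq_neg_iff_add_eq_0)
      from avoid[OF this] have 78: "a7 = 0" "a8 = 0" by simp_all
      have "a5 *\<^sub>R u + a6 *\<^sub>R J u = 0" using 0 by (simp add: 12 34 78)
      from line_0[OF this u0] have "a5 = 0" "a6 = 0" by simp_all
      then show "a1 = 0 \<and> a2 = 0 \<and> a3 = 0 \<and> a4 = 0 \<and> a5 = 0 \<and> a6 = 0 \<and> a7 = 0 \<and> a8 = 0"
        using 12 34 78 by simp
    qed
    then have surj: "surj ?f"
      using dim_ge_of_injective(2)[OF linear_comb8 _ B] dim by simp
    have K_E: "\<exists>a b f. k = a *\<^sub>R c + b *\<^sub>R J c + f \<and> f \<in> F" if k: "k \<in> K" for k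
    proof -
      obtain X where X: "k = ?f X" using surj by blast
      have "br w k = 0" using k by (simp add: K_def)
      then have "X $ 1 *\<^sub>R u + X $ 2 *\<^sub>R J u = 0"
        by (simp add: X comb8_def br_simps wx wc wu z flip: u_def)
      from line_0[OF this u0] have "X $ 1 = 0" "X $ 2 = 0" by simp_all
      then have "k = X $ 3 *\<^sub>R c + X $ 4 *\<^sub>R J c +
          (X $ 5 *\<^sub>R u + X $ 6 *\<^sub>R J u + (X $ 7 *\<^sub>R z + X $ 8 *\<^sub>R w))"
        by (simp add: X comb8_def add.assoc)
      then show ?thesis using F_I by blast
    qed
    have KJc: "br k (J c) = 0" if k: "k \<in> K" for k
    proof -
      obtain a b f where "k = a *\<^sub>R c + b *\<^sub>R J c + f" "f \<in> F" using K_E[OF k] by blast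
      then have "br (J c) k = 0" using c(3) KF KJ[OF c(1)] by (simp add: br_simps)
      then show ?thesis using br_swap[of k] by simp
    qed
    have "br k l = 0" if k: "k \<in> K" and "l \<in> K" for k l
    proof -
      obtain a b f where "l = a *\<^sub>R c + b *\<^sub>R J c + f" "f \<in> F" using K_E[OF \<open>l \<in> K\<close>] by blast
      then show ?thesis using c(3) KF KJc k by (simp add: br_simps)
    qed
    then show ?thesis
      using K KJ idealK KeqF by (intro exI[of _ K]) (auto simp: lie_ideal_def abelian_on_def)
  qed
qed

section \<open>The case D^2 \<noteq> 0\<close>

lemma frame_if_square_nonzero:
  assumes B: "finite B" "span B = (UNIV :: 'a set)" and dim: "dim (UNIV :: 'a set) \<le> 8"
    and z: "z \<noteq> 0" "\<And>X. br X z = 0"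
    and "br (J z) (br (J z) x0) \<noteq> 0"
    and no_ideal: "\<nexists>F. lie_ideal br F \<and> F \<noteq> {0} \<and> abelian_on br F \<and> J ` F \<subseteq> F"
  shows "\<exists>x y w v v' u u' z P Q m r g h. frame x y w v v' u u' z P Q m r g h"
proof -
  define w where "w = J z"
  have wJ: "br w (J X) = J (br w X)" for X unfolding w_def by (rule ad_J_central[OF z(2)])
  have wz: "br w z = 0" by (rule z(2))
  have zX: "br z X = 0" for X using z(2) br_swap[of z X] by simp
  have der: "br w (br X Y) = br (br w X) Y + br X (br w Y)" for X Y by (rule jacobi)
  have avoid: "a = 0 \<and> b = 0" if "br w X = a *\<^sub>R z + b *\<^sub>R w" for X a b
    using image_ad_avoids_line[OF z wJ[unfolded w_def]] that by (simp add: w_def)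
  let ?W = "{X. br w (br w X) = 0}"
  \<comment> \<open>\<open>engel\<close> for the single operator D provides x with D^2 x \<noteq> 0
    and D^3 x = 0.\<close>
  have "\<not> UNIV \<subseteq> ?W" using assms(6) by (auto simp: w_def)
  then obtain x where x: "x \<notin> ?W" "br w x \<in> ?W"
    by (rule engel[where S = "{w}" and U = UNIV and W = ?W, rotated]) (auto simp: br_simps)
  define v where "v = br w x"
  define u where "u = br w v"
  define y where "y = J x"
  define v' where "v' = J v"
  define u' where "u' = J u"
  have u0: "u \<noteq> 0" using x by (simp add: u_def v_def)
  have J: "J x = y" "J v = v'" "J u = u'" "J z = w" "J w = - z" "J v' = - v" "J u' = - u"
    by (simp_all add: y_def v'_def u'_def w_def)
  have wx: "br w x = v" "br w y = v'" "br w v = u" "br w v' = u'" "br w u = 0" "br w u' = 0"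
    using x(2) by (simp_all add: y_def v'_def u'_def wJ u_def v_def)
  have xw: "br x w = - v" "br y w = - v'" "br v w = - u" "br v' w = - u'"
    "br u w = 0" "br u' w = 0"
    by (simp_all add: br_swap[of _ w] wx)
  have line_u: "a = 0 \<and> b = 0" if "a *\<^sub>R u + b *\<^sub>R u' = 0" for a b
    using line_0[OF _ u0] that unfolding J by blast
  have independent: "a1 = 0 \<and> a2 = 0 \<and> a3 = 0 \<and> a4 = 0 \<and> a5 = 0 \<and> a6 = 0 \<and> a7 = 0 \<and> a8 = 0"
    if 0: "a1 *\<^sub>R x + a2 *\<^sub>R y + a3 *\<^sub>R v + a4 *\<^sub>R v' + a5 *\<^sub>R u + a6 *\<^sub>R u' + a7 *\<^sub>R z + a8 *\<^sub>R w = 0"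
      (is "?s = 0")
    for a1 a2 a3 a4 a5 a6 a7 a8
  proof -
    \<comment> \<open>D^2 isolates the coefficients of \<open>x\<close>, \<open>y\<close>, and D
      those of \<open>v\<close>, \<open>v'\<close>. The rest follows since im D avoids
      \<complex>z.\<close>
    have 1: "br w ?s = 0" unfolding 0 by (simp add: br_simps)
    have "br w (br w ?s) = 0" unfolding 1 by (simp add: br_simps)
    then have "a1 *\<^sub>R u + a2 *\<^sub>R u' = 0" by (simp add: br_simps wx wz)
    from line_u[OF this] have 12: "a1 = 0" "a2 = 0" by simp_all
    have "a3 *\<^sub>R u + a4 *\<^sub>R u' = 0" using 1 by (simp add: br_simps wx wz 12)
    from line_u[OF this] have 34: "a3 = 0" "a4 = 0" by simp_all
    have "br w (a5 *\<^sub>R v + a6 *\<^sub>R v') = (- a7) *\<^sub>R z + (- a8) *\<^sub>R w"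
      using 0 by (simp add: br_simps wx 12 34) (simp add: algebra_simps eq_neg_iff_add_eq_0)
    from avoid[OF this] have 78: "a7 = 0" "a8 = 0" by simp_all
    have "a5 *\<^sub>R u + a6 *\<^sub>R u' = 0" using 0 by (simp add: 12 34 78)
    from line_u[OF this] show ?thesis using 12 34 78 by simp
  qed
  have "inj (comb8 x y v v' u u' z w)"
    by (rule inj_comb8) (rule independent)
  then have "surj (comb8 x y v v' u u' z w)"
    using dim_ge_of_injective(2)[OF linear_comb8 _ B] dim by simp
  then have coords: "\<exists>a1 a2 a3 a4 a5 a6 a7 a8. Y = a1 *\<^sub>R x + a2 *\<^sub>R y + a3 *\<^sub>R v + a4 *\<^sub>R v'
      + a5 *\<^sub>R u + a6 *\<^sub>R u' + a7 *\<^sub>R z + a8 *\<^sub>R w" for Y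
    by (metis surjD comb8_def)
  define L where "L = {X. br w (br w X) = 0}"
  have L: "subspace L" by (auto simp: L_def subspace_def br_simps)
  have LJ: "J X \<in> L" if "X \<in> L" for X using that by (simp add: L_def wJ)
  have memL: "v \<in> L" "v' \<in> L" "u \<in> L" "u' \<in> L" "z \<in> L" "w \<in> L" "br w X \<in> L" for X
  proof -
    obtain a1 a2 a3 a4 a5 a6 a7 a8 where X: "X = a1 *\<^sub>R x + a2 *\<^sub>R y + a3 *\<^sub>R v + a4 *\<^sub>R v'
      + a5 *\<^sub>R u + a6 *\<^sub>R u' + a7 *\<^sub>R z + a8 *\<^sub>R w" using coords by blast
    show "br w X \<in> L" by (simp add: L_def X br_simps wx wz)
  qed (simp_all add: L_def br_simps wx wz)
  have coordsL: "\<exists>a b c d e f. Y = a *\<^sub>R v + b *\<^sub>R v' + c *\<^sub>R u + d *\<^sub>R u' + e *\<^sub>R z + f *\<^sub>R w"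
    if Y: "Y \<in> L" for Y
  proof -
    obtain a1 a2 a3 a4 a5 a6 a7 a8 where X: "Y = a1 *\<^sub>R x + a2 *\<^sub>R y + a3 *\<^sub>R v + a4 *\<^sub>R v'
      + a5 *\<^sub>R u + a6 *\<^sub>R u' + a7 *\<^sub>R z + a8 *\<^sub>R w" using coords by blast
    have "a1 *\<^sub>R u + a2 *\<^sub>R u' = 0" using Y by (simp add: L_def X br_simps wx wz)
    from line_u[OF this] have "Y = a3 *\<^sub>R v + a4 *\<^sub>R v' + a5 *\<^sub>R u + a6 *\<^sub>R u' + a7 *\<^sub>R z + a8 *\<^sub>R w"
      by (simp add: X)
    then show ?thesis by blast
  qed
  have coordsK: "\<exists>c d e f. Y = c *\<^sub>R u + d *\<^sub>R u' + e *\<^sub>R z + f *\<^sub>R w" if Y: "br w Y = 0" for Y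
  proof -
    have "Y \<in> L" using Y by (simp add: L_def br_simps)
    then obtain a b c d e f where X: "Y = a *\<^sub>R v + b *\<^sub>R v' + c *\<^sub>R u + d *\<^sub>R u' + e *\<^sub>R z + f *\<^sub>R w"
      using coordsL by blast
    have "a *\<^sub>R u + b *\<^sub>R u' = 0" using Y by (simp add: X br_simps wx wz)
    from line_u[OF this] have "Y = c *\<^sub>R u + d *\<^sub>R u' + e *\<^sub>R z + f *\<^sub>R w"
      by (simp add: X)
    then show ?thesis by blast
  qed
  have image_L: "\<exists>a b. br w Y = a *\<^sub>R u + b *\<^sub>R u'" if Y: "Y \<in> L" for Y
  proof -
    obtain a b c d e f where "Y = a *\<^sub>R v + b *\<^sub>R v' + c *\<^sub>R u + d *\<^sub>R u' + e *\<^sub>R z + f *\<^sub>R w"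
      using coordsL[OF Y] by blast
    then have "br w Y = a *\<^sub>R u + b *\<^sub>R u'" by (simp add: br_simps wx wz)
    then show ?thesis by blast
  qed

  have Ku: "br s u = 0 \<and> br s u' = 0" if s: "br w s = 0" for s
  proof -
    have "br s u \<in> {0} \<and> br s (J u) \<in> {0}"
    proof (rule complex_line[where S = "{s. br w s = 0}" and W' = "{0}"])
      have act: "\<exists>a b. br s (br w X) - a *\<^sub>R u - b *\<^sub>R u' \<in> {0}"
        if s: "s \<in> {s. br w s = 0}" and X: "br w X = u \<or> br w X = u'" for s X
      proof -
        \<comment> \<open>As \<open>s\<close> commutes with \<open>w\<close>, D^2 [s, X] =
          [s, D^2 X] = 0. So [s, X] lies in \<open>L\<close>, and [s, D X] = D [s, X] in the line of
          \<open>u\<close>.\<close>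
        have 0: "br w s = 0" "br w (br w X) = 0" using s X wx by auto
        have 1: "br s (br w X) = br w (br s X)" using der[of s X] by (simp add: 0 br_simps)
        have "br w (br s (br w X)) = 0" using der[of s "br w X"] by (simp add: 0 br_simps)
        then have "br s X \<in> L" by (simp add: L_def 1)
        from image_L[OF this] obtain a b where "br w (br s X) = a *\<^sub>R u + b *\<^sub>R u'" by blast
        then have "br s (br w X) - a *\<^sub>R u - b *\<^sub>R u' = 0" by (simp add: 1)
        then show ?thesis by blast
      qed
      show "\<exists>a b. br s u - a *\<^sub>R u - b *\<^sub>R J u \<in> {0}" if "s \<in> {s. br w s = 0}" for s
        using act[OF that, of v] by (simp add: wx J)
      show "\<exists>a b. br s (J u) - a *\<^sub>R u - b *\<^sub>R J u \<in> {0}" if "s \<in> {s. br w s = 0}" for s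
        using act[OF that, of v'] by (simp add: wx J)
    qed (use s u0 in \<open>auto simp: br_simps wJ\<close>)
    then show ?thesis by (simp add: J)
  qed
  have LL: "br s t \<in> L" if s: "s \<in> L" and t: "t \<in> L" for s t
  proof -
    \<comment> \<open>Here D^2 [s, t] reduces to 2 [D s, D t], which vanishes by
      \<open>Ku\<close>.\<close>
    obtain a b where "br w t = a *\<^sub>R u + b *\<^sub>R u'" using image_L[OF t] by blast
    moreover have 0: "br w (br w s) = 0" "br w (br w t) = 0" using s t by (simp_all add: L_def)
    ultimately have "br (br w s) (br w t) = 0" using Ku[of "br w s"] by (simp add: br_simps)
    then have "br w (br w (br s t)) = 0"
      using der[of s t] der[of "br w s" t] der[of s "br w t"] by (simp add: 0 br_simps)
    then show ?thesis by (simp add: L_def)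
  qed
  have xL: "x \<notin> L" using x by (simp add: L_def)
  have mod_L: "\<exists>a b. Y - a *\<^sub>R x - b *\<^sub>R J x \<in> L" for Y
  proof -
    obtain a1 a2 a3 a4 a5 a6 a7 a8 where X: "Y = a1 *\<^sub>R x + a2 *\<^sub>R y + a3 *\<^sub>R v + a4 *\<^sub>R v'
      + a5 *\<^sub>R u + a6 *\<^sub>R u' + a7 *\<^sub>R z + a8 *\<^sub>R w" using coords by blast
    have "Y - a1 *\<^sub>R x - a2 *\<^sub>R J x \<in> L"
      by (simp add: X J L_def br_simps wx wz)
    then show ?thesis by blast
  qed
  \<comment> \<open>The quotient by \<open>L\<close> = ker D^2 is a complex line, so
    \<open>L\<close> acts trivially on it.\<close>
  have Lx: "br s x \<in> L \<and> br s (J x) \<in> L" if "s \<in> L" for s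
    by (rule complex_line[where S = L and W = L and W' = L, OF LJ L LL L subset_refl LJ xL mod_L mod_L that])
      simp_all
  have idealL: "br X s \<in> L" if s: "s \<in> L" for X s
  proof -
    obtain a b where ab: "X - a *\<^sub>R x - b *\<^sub>R J x \<in> L" using mod_L by blast
    have "a *\<^sub>R br s x + b *\<^sub>R br s (J x) \<in> L"
      using Lx[OF s] by (intro subspace_add[OF L] subspace_scale[OF L]) auto
    with LL[OF s ab]
    have "br s (X - a *\<^sub>R x - b *\<^sub>R J x) + (a *\<^sub>R br s x + b *\<^sub>R br s (J x)) \<in> L"
      by (rule subspace_add[OF L])
    then have "br s X \<in> L" by (simp add: br_simps)
    then show ?thesis using subspace_neg[OF L] br_swap[of X s] by simp
  qed
  have Lu: "br s u = 0 \<and> br s u' = 0" if s: "s \<in> L" for s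
  proof -
    have act: "\<exists>a b. br s q - a *\<^sub>R u - b *\<^sub>R u' \<in> {0}"
      if s: "s \<in> L" and q: "q = u \<or> q = u'" for s q
    proof -
      obtain a b c d e f where
        "s = a *\<^sub>R v + b *\<^sub>R v' + c *\<^sub>R u + d *\<^sub>R u' + e *\<^sub>R z + f *\<^sub>R w"
        using coordsL[OF s] by blast
      \<comment> \<open>Up to ker D, which kills \<open>q\<close>, \<open>s\<close> is D p with p =
        ax + by, so [s, q] = D [p, q]. Since D [s, q] = [D s, q] = 0, [p, q] lies in
        \<open>L\<close>, which D maps into the line of \<open>u\<close>.\<close>
      then have s_eq: "s = br w (a *\<^sub>R x + b *\<^sub>R y) + (c *\<^sub>R u + d *\<^sub>R u' + e *\<^sub>R z + f *\<^sub>R w)"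
        (is "_ = _ + ?k")
        by (simp add: br_simps wx)
      have wq: "br w q = 0" using q wx by auto
      have "br w (c *\<^sub>R u + d *\<^sub>R u' + e *\<^sub>R z + f *\<^sub>R w) = 0" by (simp add: br_simps wx wz)
      from Ku[OF this] have kq: "br ?k q = 0" using q by blast
      have 1: "br s q = br w (br (a *\<^sub>R x + b *\<^sub>R y) q)"
        unfolding s_eq der[of _ q] wq bilinear_ladd[OF bilinear_br, of _ ?k] kq
        by (simp add: br_simps)
      have "br w (br w s) = 0" using s by (simp add: L_def)
      from Ku[OF this] have "br (br w s) q = 0" using q by auto
      then have "br w (br s q) = 0" by (simp add: der wq br_simps)
      then have "br (a *\<^sub>R x + b *\<^sub>R y) q \<in> L" by (simp add: L_def 1)
      from image_L[OF this] obtain a' b' where "br s q = a' *\<^sub>R u + b' *\<^sub>R u'" unfolding 1 by blast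
      then have "br s q - a' *\<^sub>R u - b' *\<^sub>R u' = 0" by simp
      then show ?thesis by blast
    qed
    have "br s u \<in> {0} \<and> br s (J u) \<in> {0}"
    proof (rule complex_line[where S = L and W' = "{0}"])
      show "\<exists>a b. br s u - a *\<^sub>R u - b *\<^sub>R J u \<in> {0}"
        "\<exists>a b. br s (J u) - a *\<^sub>R u - b *\<^sub>R J u \<in> {0}" if "s \<in> L" for s
        using act[OF that] by (simp_all add: J)
    qed (use s u0 LJ in \<open>auto simp: br_simps\<close>)
    then show ?thesis by (simp add: J)
  qed
  note Lu_simps = Lu[OF memL(1)] Lu[OF memL(2)] Lu[OF memL(3)] Lu[OF memL(4)]
  have uv: "br u v = 0" "br u' v = 0" "br u v' = 0" "br u' v' = 0"
    using Lu_simps br_swap[of u v] br_swap[of u' v] br_swap[of u v'] br_swap[of u' v'] by simp_all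

  \<comment> \<open>This real space omits the direction \<open>w\<close>; the later absorption and
    eigenvalue arguments for \<open>v\<close> and \<open>v'\<close> work modulo it.\<close>
  define C where "C = {a *\<^sub>R u + b *\<^sub>R u' + c *\<^sub>R z | a b c. True}"
  have C_I: "a *\<^sub>R u + b *\<^sub>R u' + c *\<^sub>R z \<in> C" for a b c by (auto simp: C_def)
  have C: "subspace C"
    unfolding subspace_def
  proof (intro conjI ballI allI)
    show "0 \<in> C" using C_I[of 0 0 0] by simp
  next
    fix X Y assume "X \<in> C" "Y \<in> C"
    then obtain a b c a' b' c' where
      "X = a *\<^sub>R u + b *\<^sub>R u' + c *\<^sub>R z" "Y = a' *\<^sub>R u + b' *\<^sub>R u' + c' *\<^sub>R z"
      by (auto simp: C_def)
    then show "X + Y \<in> C" using C_I[of "a + a'" "b + b'" "c + c'"] by (simp add: algebra_simps)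
  next
    fix k X assume "X \<in> C"
    then obtain a b c where "X = a *\<^sub>R u + b *\<^sub>R u' + c *\<^sub>R z" by (auto simp: C_def)
    then show "k *\<^sub>R X \<in> C" using C_I[of "k * a" "k * b" "k * c"] by (simp add: algebra_simps)
  qed
  have gu_C: "br X q \<in> C" if q: "q = u \<or> q = u'" for X q
  proof -
    have wq: "br w q = 0" using q wx by auto
    have L_q: "br s q = 0" if "s \<in> L" for s using Lu[OF that] q by auto
    have "br w (br X q) = 0" by (simp add: der wq L_q memL br_simps)
    then obtain a b c d where *: "br X q = a *\<^sub>R u + b *\<^sub>R u' + c *\<^sub>R z + d *\<^sub>R w"
      using coordsK by blast
    have "br v X \<in> L" using idealL[OF memL(1), of X] subspace_neg[OF L] br_swap[of v X] by simp
    then have "br v (br X q) = 0" by (simp add: jacobi[of v X] L_q memL br_simps)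
    \<comment> \<open>The coefficient of \<open>w\<close> is detected by [v, w] = -u.\<close>
    then have "d *\<^sub>R u = 0" unfolding * by (simp add: br_simps Lu_simps z xw)
    then have "d = 0" using u0 by simp
    then show ?thesis using * C_I by simp
  qed
  \<comment> \<open>The real line of \<open>z\<close> is not \<open>J\<close>-stable, hence the
    larger space \<open>line z\<close> for \<open>W'\<close>.\<close>
  have "br X u \<in> {c *\<^sub>R z | c. True} \<and> br X (J u) \<in> {c *\<^sub>R z | c. True}" for X
  proof (rule complex_line[where S = UNIV and W' = "line z"])
    show "subspace {c *\<^sub>R z | c. True}"
      using subspace_span[of "{z}"] by (simp add: span_singleton image_def)
    show "subspace (line z)" by (rule subspace_line)
    show "{c *\<^sub>R z | c. True} \<subseteq> line z" using lineI[of _ z 0] by auto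
    show "J X \<in> line z" if "X \<in> line z" for X using that by (rule J_line)
    show "br s X \<in> {c *\<^sub>R z | c. True}" if "X \<in> {c *\<^sub>R z | c. True}" for s X
      using that by (auto simp: br_simps z intro!: exI[of _ 0])
    show "u \<notin> line z"
    proof
      assume "u \<in> line z"
      then obtain a b where "br w v = a *\<^sub>R z + b *\<^sub>R w" by (auto simp: line_def wx J)
      then show False using avoid[of v a b] u0 by (simp add: wx)
    qed
    fix s
    have *: "\<exists>a b. br s q - a *\<^sub>R u - b *\<^sub>R J u \<in> {c *\<^sub>R z | c. True}" if q: "q = u \<or> q = u'" for q
    proof -
      obtain a b c where "br s q = a *\<^sub>R u + b *\<^sub>R u' + c *\<^sub>R z" using gu_C[OF q, of s] by (auto simp: C_def)
      then have "br s q - a *\<^sub>R u - b *\<^sub>R J u = c *\<^sub>R z" by (simp add: J)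
      then show ?thesis by blast
    qed
    show "\<exists>a b. br s u - a *\<^sub>R u - b *\<^sub>R J u \<in> {c *\<^sub>R z | c. True}" by (rule *) simp
    show "\<exists>a b. br s (J u) - a *\<^sub>R u - b *\<^sub>R J u \<in> {c *\<^sub>R z | c. True}" by (rule *) (simp add: J)
  qed auto
  then have gu: "\<exists>c. br X u = c *\<^sub>R z" "\<exists>c. br X u' = c *\<^sub>R z" for X by (auto simp: J)

  obtain p q where pq: "br x u = p *\<^sub>R z" "br x u' = q *\<^sub>R z" using gu by blast
  obtain p1 q1 where pq1: "br y u = p1 *\<^sub>R z" "br y u' = q1 *\<^sub>R z" using gu by blast
  \<comment> \<open>D [x, v] = [v, v] + [x, u] is a multiple of \<open>z\<close>, and im D avoids
    \<complex>z.\<close>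
  have "br w (br x v) = p *\<^sub>R z + 0 *\<^sub>R w" by (simp add: der wx pq)
  from avoid[OF this] have p: "p = 0" by simp
  have "(- q1) *\<^sub>R z + (p1 + q) *\<^sub>R J z = 0"
    using nijenhuis[of x u] by (simp add: J pq pq1 p) (simp add: algebra_simps)
  from line_0[OF this z(1)] have q1: "q1 = 0" "p1 = - q" by auto
  have xu: "br x u = 0" "br x u' = q *\<^sub>R z" "br y u = - (q *\<^sub>R z)" "br y u' = 0"
    using pq pq1 p q1 by simp_all
  \<comment> \<open>For \<open>q = 0\<close> the line of \<open>u\<close> would be central, hence an
    abelian invariant ideal.\<close>
  have q: "q \<noteq> 0"
  proof
    assume "q = 0"
    have "br X u = 0 \<and> br X u' = 0" for X
    proof -
      obtain a b where "X - a *\<^sub>R x - b *\<^sub>R J x \<in> L" using mod_L by blast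
      from Lu[OF this] show ?thesis by (simp add: br_simps J xu \<open>q = 0\<close>)
    qed
    then have central: "br X s = 0" if "s \<in> line u" for X s
      using that by (auto simp: line_def J br_simps)
    have "line u \<noteq> {0}" using lineI[of 1 u 0] u0 by auto
    then have "lie_ideal br (line u) \<and> line u \<noteq> {0} \<and> abelian_on br (line u) \<and> J ` line u \<subseteq> line u"
      using subspace_line[of u] J_line[of _ u]
      by (auto simp: lie_ideal_def abelian_on_def central subspace_0)
    then show False using no_ideal by blast
  qed

  have gC: "br s Y \<in> C" if "Y \<in> C" for s Y
  proof -
    obtain a b c where "Y = a *\<^sub>R u + b *\<^sub>R u' + c *\<^sub>R z" using \<open>Y \<in> C\<close> by (auto simp: C_def)
    then have "br s Y = a *\<^sub>R br s u + b *\<^sub>R br s u'" by (simp add: br_simps z)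
    then show ?thesis
      using gu_C[of u s] gu_C[of u' s] by (simp add: subspace_add[OF C] subspace_scale[OF C])
  qed
  have no_w: "f = 0" if s: "s \<in> L"
    and eq: "br X s = a *\<^sub>R v + b *\<^sub>R v' + c *\<^sub>R u + d *\<^sub>R u' + e *\<^sub>R z + f *\<^sub>R w" for X s a b c d e f
  proof (rule ccontr)
    assume f: "f \<noteq> 0"
    \<comment> \<open>Brackets with \<open>w\<close> already put \<open>v\<close> and
      \<open>v'\<close> into \<open>?R\<close>. With \<open>w\<close> it would contain
      \<open>L\<close>, and \<open>absorb\<close> would give \<open>L \<subseteq> C\<close>.\<close>
    let ?R = "span (C \<union> {br s m | s m. s \<in> UNIV \<and> m \<in> L})"
    note R = span_add span_diff span_scale
    have R_br: "br X m \<in> ?R" if "m \<in> L" for X m using that by (auto intro: span_base)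
    have vR: "v \<in> ?R" using span_neg[OF R_br[OF memL(6), of x]] by (simp add: xw)
    have v'R: "v' \<in> ?R" using span_neg[OF R_br[OF memL(6), of y]] by (simp add: xw)
    have C_R: "a *\<^sub>R u + b *\<^sub>R u' + c *\<^sub>R z \<in> ?R" for a b c using C_I by (auto intro: span_base)
    have "br X s - (a *\<^sub>R v + b *\<^sub>R v' + (c *\<^sub>R u + d *\<^sub>R u' + e *\<^sub>R z)) \<in> ?R"
      by (intro span_diff[OF R_br[OF s]] span_add[OF _ C_R] span_add span_scale vR v'R)
    then have "f *\<^sub>R w \<in> ?R" by (simp add: eq algebra_simps)
    from span_scale[OF this, of "1 / f"] have wR: "w \<in> ?R" using f by simp
    have "L \<subseteq> ?R"
    proof
      fix Y assume "Y \<in> L"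
      then obtain a b c d e f where "Y = a *\<^sub>R v + b *\<^sub>R v' + c *\<^sub>R u + d *\<^sub>R u' + e *\<^sub>R z + f *\<^sub>R w"
        using coordsL by blast
      then have Y: "Y = a *\<^sub>R v + b *\<^sub>R v' + (c *\<^sub>R u + d *\<^sub>R u' + e *\<^sub>R z) + f *\<^sub>R w"
        by (simp add: algebra_simps)
      show "Y \<in> ?R" unfolding Y
        by (intro span_add[OF span_add[OF _ C_R]] span_add span_scale vR v'R wR)
    qed
    then have "L \<subseteq> C" by (intro absorb[where S = UNIV, OF C gC]) auto
    then have "w \<in> C" using memL by blast
    then obtain a b c where "w = a *\<^sub>R u + b *\<^sub>R u' + c *\<^sub>R z" by (auto simp: C_def)
    then show False using independent[of 0 0 0 0 a b c "- 1"] by simp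
  qed
  have gL: "\<exists>a b c d e. br X s = a *\<^sub>R v + b *\<^sub>R v' + c *\<^sub>R u + d *\<^sub>R u' + e *\<^sub>R z" if s: "s \<in> L" for X s
  proof -
    obtain a b c d e f where
      *: "br X s = a *\<^sub>R v + b *\<^sub>R v' + c *\<^sub>R u + d *\<^sub>R u' + e *\<^sub>R z + f *\<^sub>R w"
      using coordsL[OF idealL[OF s]] by blast
    with no_w[OF s *] have "br X s = a *\<^sub>R v + b *\<^sub>R v' + c *\<^sub>R u + d *\<^sub>R u' + e *\<^sub>R z" by simp
    then show ?thesis by blast
  qed
  obtain cv dv k1 k2 k3 where xv': "br x v' = cv *\<^sub>R v + dv *\<^sub>R v' + k1 *\<^sub>R u + k2 *\<^sub>R u' + k3 *\<^sub>R z"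
    using gL[OF memL(2)] by blast
  obtain cv1 dv1 l1 l2 l3 where yv: "br y v = cv1 *\<^sub>R v + dv1 *\<^sub>R v' + l1 *\<^sub>R u + l2 *\<^sub>R u' + l3 *\<^sub>R z"
    using gL[OF memL(1)] by blast
  obtain a1 b1 A Bu m1 where xv: "br x v = a1 *\<^sub>R v + b1 *\<^sub>R v' + A *\<^sub>R u + Bu *\<^sub>R u' + m1 *\<^sub>R z"
    using gL[OF memL(1)] by blast
  obtain a2 b2 A1 B1 m2 where yv': "br y v' = a2 *\<^sub>R v + b2 *\<^sub>R v' + A1 *\<^sub>R u + B1 *\<^sub>R u' + m2 *\<^sub>R z"
    using gL[OF memL(2)] by blast
  \<comment> \<open>Applying the derivation D turns the \<open>v\<close> and \<open>v'\<close>
    components into coefficients of \<open>u\<close> and \<open>u'\<close>, which can be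
    compared.\<close>
  have "a1 *\<^sub>R u + b1 *\<^sub>R u' = br w (br x v)" by (simp add: xv br_simps wx wz)
  also have "\<dots> = 0" by (simp add: der wx xu)
  finally have ab1: "a1 = 0" "b1 = 0" using line_u by blast+
  have "a2 *\<^sub>R u + b2 *\<^sub>R u' = br w (br y v')" by (simp add: yv' br_simps wx wz)
  also have "\<dots> = 0" by (simp add: der wx xu)
  finally have ab2: "a2 = 0" "b2 = 0" using line_u by blast+
  have "cv *\<^sub>R u + dv *\<^sub>R u' = br w (br x v')" by (simp add: xv' br_simps wx wz)
  also have "\<dots> = br v v' + q *\<^sub>R z" by (simp add: der wx xu)
  finally have vv': "br v v' = cv *\<^sub>R u + dv *\<^sub>R u' - q *\<^sub>R z" by (simp add: algebra_simps)
  have "cv1 *\<^sub>R u + dv1 *\<^sub>R u' = br w (br y v)" by (simp add: yv br_simps wx wz)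
  also have "\<dots> = - (cv *\<^sub>R u) - dv *\<^sub>R u'" by (simp add: der wx xu br_swap[of v' v] vv')
  finally have "cv1 *\<^sub>R u + dv1 *\<^sub>R u' + (cv *\<^sub>R u + dv *\<^sub>R u') = 0" by simp
  then have "(cv1 + cv) *\<^sub>R u + (dv1 + dv) *\<^sub>R u' = 0" by (simp add: algebra_simps)
  from line_u[OF this] have cd1: "cv1 = - cv" "dv1 = - dv" by auto
  \<comment> \<open>Modulo \<open>C\<close> the combination of \<open>v\<close>, \<open>v'\<close>
    with these coefficients is an eigenvector of \<open>x\<close> with eigenvalue \<open>dv\<close>
    and of \<open>y\<close> with eigenvalue \<open>- cv\<close>.\<close>
  have "cv = 0 \<and> dv = 0"
  proof (cases "cv *\<^sub>R v + dv *\<^sub>R v' \<in> C")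
    case True
    then obtain a b c where "cv *\<^sub>R v + dv *\<^sub>R v' = a *\<^sub>R u + b *\<^sub>R u' + c *\<^sub>R z" by (auto simp: C_def)
    then show ?thesis using independent[of 0 0 cv dv "- a" "- b" "- c" 0] by (simp add: algebra_simps)
  next
    case False
    have "br x (cv *\<^sub>R v + dv *\<^sub>R v') - dv *\<^sub>R (cv *\<^sub>R v + dv *\<^sub>R v') =
        (cv * A + dv * k1) *\<^sub>R u + (cv * Bu + dv * k2) *\<^sub>R u' + (cv * m1 + dv * k3) *\<^sub>R z"
      by (simp add: br_simps xv xv' ab1 algebra_simps)
    also have "\<dots> \<in> C" by (rule C_I)
    finally have "dv = 0" using no_eigenvector[OF C gC] False by blast
    have "br y (cv *\<^sub>R v + dv *\<^sub>R v') - (- cv) *\<^sub>R (cv *\<^sub>R v + dv *\<^sub>R v') =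
        (cv * l1 + dv * A1) *\<^sub>R u + (cv * l2 + dv * B1) *\<^sub>R u' + (cv * l3 + dv * m2) *\<^sub>R z"
      by (simp add: br_simps yv yv' ab2 cd1 algebra_simps)
    also have "\<dots> \<in> C" by (rule C_I)
    finally have "- cv = 0" using no_eigenvector[OF C gC] False by blast
    then show ?thesis using \<open>dv = 0\<close> by simp
  qed
  then have cd: "cv = 0" "dv = 0" by simp_all
  obtain s1 s2 e f g h r n where
    xy0: "br x y = s1 *\<^sub>R x + s2 *\<^sub>R y + e *\<^sub>R v + f *\<^sub>R v' + g *\<^sub>R u + h *\<^sub>R u' + r *\<^sub>R z + n *\<^sub>R w"
    using coords by blast
  \<comment> \<open>The same eigenvector argument, now for \<open>x\<close>, \<open>y\<close> modulo
    \<open>L\<close>.\<close>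
  have s12: "s1 = 0 \<and> s2 = 0"
  proof (cases "s1 *\<^sub>R x + s2 *\<^sub>R y \<in> L")
    case True
    then show ?thesis using line_inj[OF L LJ xL] by (simp add: J)
  next
    case False
    have mem: "a *\<^sub>R (e *\<^sub>R v + f *\<^sub>R v' + g *\<^sub>R u + h *\<^sub>R u' + r *\<^sub>R z + n *\<^sub>R w) \<in> L" for a
      by (intro subspace_add[OF L] subspace_scale[OF L] memL)
    have "br x (s1 *\<^sub>R x + s2 *\<^sub>R y) - s2 *\<^sub>R (s1 *\<^sub>R x + s2 *\<^sub>R y) =
        s2 *\<^sub>R (e *\<^sub>R v + f *\<^sub>R v' + g *\<^sub>R u + h *\<^sub>R u' + r *\<^sub>R z + n *\<^sub>R w)"
      by (simp add: br_simps xy0 algebra_simps)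
    also have "\<dots> \<in> L" by (rule mem)
    finally have "s2 = 0" using no_eigenvector[OF L idealL] False by blast
    have "br y (s1 *\<^sub>R x + s2 *\<^sub>R y) - (- s1) *\<^sub>R (s1 *\<^sub>R x + s2 *\<^sub>R y) =
        (- s1) *\<^sub>R (e *\<^sub>R v + f *\<^sub>R v' + g *\<^sub>R u + h *\<^sub>R u' + r *\<^sub>R z + n *\<^sub>R w)"
      by (simp add: br_simps br_swap[of y x] xy0 algebra_simps)
    also have "\<dots> \<in> L" by (rule mem)
    finally have "- s1 = 0" using no_eigenvector[OF L idealL] False by blast
    then show ?thesis using \<open>s2 = 0\<close> by simp
  qed
  note table = xv[unfolded ab1 scaleR_zero_left add_0_left] yv'[unfolded ab2 scaleR_zero_left add_0_left]
    xv'[unfolded cd scaleR_zero_left add_0_left] yv[unfolded cd1 cd neg_0_equal_iff_equal minus_zero scaleR_zero_left add_0_left]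
    vv'[unfolded cd scaleR_zero_left add_0_left diff_0]
    xy0[unfolded s12[THEN conjunct1] s12[THEN conjunct2] scaleR_zero_left add_0_left]
  have v'v: "br v' v = q *\<^sub>R z" using br_swap[of v' v] table(5) by simp
  have uz: "a = 0 \<and> b = 0 \<and> c = 0 \<and> d = 0" if "a *\<^sub>R u + b *\<^sub>R u' + c *\<^sub>R z + d *\<^sub>R w = 0" for a b c d
    using independent[of 0 0 0 0 a b c d] that by simp

  \<comment> \<open>The remaining relations come from the derivation D on [x, y], integrability for
    x and v, and the Jacobi identity for x, y with v or v'.\<close>
  have "(k1 - l1 - e) *\<^sub>R u + (k2 - l2 - f) *\<^sub>R u' + (k3 - l3) *\<^sub>R z + 0 *\<^sub>R w = 0"
    using der[of x y] br_swap[of v y] by (simp add: table br_simps wx wz) (simp add: algebra_simps)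
  from uz[OF this] have e: "e = k1 - l1" and f: "f = k2 - l2" and l3: "l3 = k3" by auto
  have "(A - l2 - k2 - A1) *\<^sub>R u + (Bu + l1 + k1 - B1) *\<^sub>R u' + (m1 - m2) *\<^sub>R z + (l3 + k3) *\<^sub>R w = 0"
    using nijenhuis[of x v] by (simp add: J table) (simp add: algebra_simps)
  from uz[OF this] l3 have A1: "A1 = A - l2 - k2" and B1: "B1 = Bu + l1 + k1" and m2: "m2 = m1"
    and k3: "k3 = 0" by auto
  have "(- n) *\<^sub>R u + 0 *\<^sub>R u' + (l2 * q - f * q + A * q) *\<^sub>R z + 0 *\<^sub>R w = 0"
    using jacobi[of x y v] by (simp add: table br_simps xu v'v z uv wx zX Lu_simps) (simp add: algebra_simps)
  from uz[OF this] q have n: "n = 0" and f2: "f = l2 + A" by (auto simp flip: left_diff_distrib distrib_right)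
  have "(- n) *\<^sub>R u' + (B1 * q + e * q + k1 * q) *\<^sub>R z = 0"
    using jacobi[of x y v'] by (simp add: table br_simps xu v'v z uv wx zX Lu_simps) (simp add: algebra_simps)
  then have "(B1 + e + k1) * q = 0" using z(1) by (simp add: n algebra_simps flip: scaleR_add_left)
  then have B1': "B1 = - e - k1" using q by simp
  have k2: "k2 = 2 * l2 + A" using f f2 by simp
  have Bu: "Bu = - 3 * k1" using B1 B1' e by simp
  have A1': "A1 = - 3 * l2" using A1 k2 by simp
  have B1'': "B1 = l1 - 2 * k1" using B1' e by simp
  \<comment> \<open>The multiples of \<open>w\<close> clear the \<open>v\<close> and
    \<open>v'\<close> components of [x, y], and the factor \<open>q\<close> normalizes
    [x, u'].\<close>
  have "frame (x - f *\<^sub>R w) (y + e *\<^sub>R w) w v v' u u' (q *\<^sub>R z) l2 k1 (m1 / q) (r / q) g h"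
    unfolding frame_def
    using q z(1)
    by (simp add: br_simps wx wz xw xu table v'v z uv Lu_simps)
      (simp add: e f2 l3 k3 m2 n k2 Bu A1' B1'' algebra_simps numeral_split)
  then show ?thesis by blast
qed

end

section \<open>Assembling the equivalence\<close>

theorem theorem5p1:
  fixes br :: "'a::real_vector \<Rightarrow> 'a \<Rightarrow> 'a" and J :: "'a \<Rightarrow> 'a"
  assumes "\<exists>B::'a set. finite B \<and> span B = UNIV"
    and "0 < dim (UNIV :: 'a set)"
    and "dim (UNIV :: 'a set) \<le> 8"
    and "lie_algebra br"
    and "nilpotent_lie br"
    and "complex_structure br J"
  shows "(\<exists>F. lie_ideal br F \<and> F \<noteq> {0} \<and> abelian_on br F \<and> J ` F \<subseteq> F) \<longleftrightarrow>
    \<not> ((\<exists>\<gamma>\<in>{0, 1}. lie_isomorphic br (g9 \<gamma>)) \<or>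
       (\<exists>(\<alpha>, \<beta>)\<in>{(0, 0), (1, 0), (0, 1)} \<union> {(a, 1) | a. 0 < a}. lie_isomorphic br (g11 \<alpha> \<beta>)))"
proof -
  interpret nilpotent_complex br J
    using assms(4-6) by unfold_locales
  obtain B :: "'a set" where B: "finite B" "span B = UNIV" using assms(1) by blast
  have obstruct_g9: "\<not> lie_isomorphic br (g9 \<gamma>)"
    if "lie_ideal br F" "F \<noteq> {0}" "abelian_on br F" "J ` F \<subseteq> F" for F \<gamma>
    using abelian_ideal_obstructs[OF that, of "g9 \<gamma>"] by (metis g9_center g9_square)
  have obstruct_g11: "\<not> lie_isomorphic br (g11 \<alpha> \<beta>)"
    if "lie_ideal br F" "F \<noteq> {0}" "abelian_on br F" "J ` F \<subseteq> F" for F \<alpha> \<beta>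
    using abelian_ideal_obstructs[OF that, of "g11 \<alpha> \<beta>"] by (metis g11_center g11_square)
  have classified: "(\<exists>\<gamma>\<in>{0, 1}. lie_isomorphic br (g9 \<gamma>)) \<or>
    (\<exists>(\<alpha>, \<beta>)\<in>{(0, 0), (1, 0), (0, 1)} \<union> {(a, 1) | a. 0 < a}. lie_isomorphic br (g11 \<alpha> \<beta>))"
    if no_ideal: "\<nexists>F. lie_ideal br F \<and> F \<noteq> {0} \<and> abelian_on br F \<and> J ` F \<subseteq> F"
  proof -
    have "(UNIV :: 'a set) \<noteq> {0}"
    proof
      assume "(UNIV :: 'a set) = {0}"
      then have "dim (UNIV :: 'a set) = dim ({0} :: 'a set)" by simp
      also have "\<dots> = 0" using dim_le_card[of "{0 :: 'a}" "{}"] by simp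
      finally show False using assms(2) by simp
    qed
    moreover have "lie_ideal br UNIV" by (simp add: lie_ideal_def)
    ultimately obtain z where z: "z \<noteq> 0" "\<And>X. br X z = 0"
      using center_meets_ideal[of UNIV] by blast
    \<comment> \<open>Of the cases D = 0, D \<noteq> 0 = D^2 and D^2 \<noteq> 0 for D = [J z, .],
      the first two produce an ideal. The last leads to a frame.\<close>
    have "br (J z) x \<noteq> 0 \<Longrightarrow> \<exists>X. br (J z) (br (J z) X) \<noteq> 0" for x
      using abelian_ideal_if_square_zero[OF B assms(3) z] no_ideal by blast
    moreover have "\<exists>x. br (J z) x \<noteq> 0"
    proof (rule ccontr)
      assume "\<nexists>x. br (J z) x \<noteq> 0"
      then have "br X (J z) = 0" for X using br_swap[of X "J z"] by simp
      then have "br X Y = 0" if "Y \<in> line z" for X Y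
        using that z by (auto simp: line_def br_simps)
      moreover have "line z \<noteq> {0}" using lineI[of 1 z 0] z(1) by auto
      ultimately show False
        using no_ideal subspace_line[of z] J_line[of _ z]
        by (auto simp: lie_ideal_def abelian_on_def subspace_0 dest!: spec[of _ "line z"])
    qed
    ultimately obtain x where "br (J z) (br (J z) x) \<noteq> 0" by blast
    from frame_if_square_nonzero[OF B assms(3) z this no_ideal]
    show ?thesis using frame_classified[OF _ B assms(3)] by blast
  qed
  show ?thesis using obstruct_g9 obstruct_g11 classified by blast
qed

end
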